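(* Let $n,m,k$ be positive integers and $X=\mathbb{P}^n\times\mathbb{P}^n\times\mathbb{P}^m\times\mathbb{P}^m$. Then there exists a linear monad on $X$ of the form \[0\to \mathcal{O}_X(-1,-1,-1,-1)^{\oplus k}\xrightarrow{f}\mathscr{G}_n\oplus\mathscr{G}_m\xrightarrow{g}\mathcal{O}_X(1,1,1,1)^{\oplus k}\to 0,\] where $\mathscr{G}_n=\mathcal{O}_X(0,-1,0,0)^{\oplus n+k}\oplus\mathcal{O}_X(-1,0,0,0)^{\oplus n+k}$ and $\mathscr{G}_m=\mathcal{O}_X(0,0,-1,0)^{\oplus m+k}\oplus\mathcal{O}_X(0,0,0,-1)^{\oplus m+k}$.
   Context: $\mathcal{O}_X(a,b,c,d)=p_1^*\mathcal{O}_{\mathbb{P}^n}(a)\otimes p_2^*\mathcal{O}_{\mathbb{P}^n}(b)\otimes p_3^*\mathcal{O}_{\mathbb{P}^m}(c)\otimes p_4^*\mathcal{O}_{\mathbb{P}^m}(d)$, with $p_i$ the projections to the factors. A monad on $X$ is a complex of vector bundles $0\to M_0\xrightarrow{\alpha}M_1\xrightarrow{\beta}M_2\to0$ with $\alpha$ injective (as a bundle map), $\beta$ surjective and $\beta\circ\alpha=0$; it is called linear when its maps are given by matrices of linear forms.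
   Formalization: "Linear" is dropped: the twists force entries of f to have multidegree such as (1,0,1,1) and of g such as (1,2,1,1), so nonzero linear forms are impossible; the maps are matrices of multihomogeneous forms of the forced multidegrees, over the complex numbers. *)

theory Defs
  imports Complex_Main
begin

text \<open>Concrete model of X = P^n x P^n x P^m x P^m over the complex numbers.
 A point of the affine cone is a 4-tuple of coordinate vectors; the vectors
 of the first two factors use indices 0..n, the last two use indices 0..m.\<close>

type_synonym pt = "(nat \<Rightarrow> complex) \<times> (nat \<Rightarrow> complex) \<times> (nat \<Rightarrow> complex) \<times> (nat \<Rightarrow> complex)"

type_synonym twist = "int \<times> int \<times> int \<times> int"

text \<open>Exponent vectors of monomials of degree d in the variables 0..N
 (empty if d < 0).\<close>
definition exps :: "nat \<Rightarrow> int \<Rightarrow> (nat \<Rightarrow> nat) set" where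
  "exps N d = {e. (\<forall>i>N. e i = 0) \<and> int (\<Sum>i\<le>N. e i) = d}"

definition monom :: "nat \<Rightarrow> (nat \<Rightarrow> nat) \<Rightarrow> (nat \<Rightarrow> complex) \<Rightarrow> complex" where
  "monom N e x = (\<Prod>i\<le>N. x i ^ e i)"

text \<open>F is (the function of) a multihomogeneous polynomial of multidegree
 (a,b,c,d), i.e. a global section of O_X(a,b,c,d); zero if some degree is negative.\<close>
definition multihom :: "nat \<Rightarrow> nat \<Rightarrow> twist \<Rightarrow> (pt \<Rightarrow> complex) \<Rightarrow> bool" where
  "multihom n m t F \<longleftrightarrow> (case t of (a, b, c, d) \<Rightarrow>
     (\<exists>C. \<forall>x y z w. F (x, y, z, w) =
        (\<Sum>e1\<in>exps n a. \<Sum>e2\<in>exps n b. \<Sum>e3\<in>exps m c. \<Sum>e4\<in>exps m d.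
           C e1 e2 e3 e4 * monom n e1 x * monom n e2 y * monom m e3 z * monom m e4 w)))"

definition twist_diff :: "twist \<Rightarrow> twist \<Rightarrow> twist" where
  "twist_diff t s = (case t of (a,b,c,d) \<Rightarrow> case s of (a',b',c',d') \<Rightarrow> (a-a', b-b', c-c', d-d'))"

text \<open>A morphism from the direct sum of the line bundles O_X(L1!j) to the direct
 sum of the O_X(L2!i): a matrix whose (i,j) entry is a section of
 O_X(L2!i - L1!j).\<close>
definition is_morphism :: "nat \<Rightarrow> nat \<Rightarrow> twist list \<Rightarrow> twist list \<Rightarrow> (nat \<Rightarrow> nat \<Rightarrow> pt \<Rightarrow> complex) \<Rightarrow> bool" where
  "is_morphism n m L1 L2 A \<longleftrightarrow>
     (\<forall>i<length L2. \<forall>j<length L1. multihom n m (twist_diff (L2!i) (L1!j)) (A i j))"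

definition in_X :: "nat \<Rightarrow> nat \<Rightarrow> pt \<Rightarrow> bool" where
  "in_X n m p = (case p of (x, y, z, w) \<Rightarrow>
     (\<exists>i\<le>n. x i \<noteq> 0) \<and> (\<exists>i\<le>n. y i \<noteq> 0) \<and> (\<exists>i\<le>m. z i \<noteq> 0) \<and> (\<exists>i\<le>m. w i \<noteq> 0))"

definition inj_at :: "nat \<Rightarrow> nat \<Rightarrow> (nat \<Rightarrow> nat \<Rightarrow> pt \<Rightarrow> complex) \<Rightarrow> pt \<Rightarrow> bool" where
  "inj_at r s A p \<longleftrightarrow> (\<forall>v. (\<forall>i<s. (\<Sum>j<r. A i j p * v j) = 0) \<longrightarrow> (\<forall>j<r. v j = 0))"

definition surj_at :: "nat \<Rightarrow> nat \<Rightarrow> (nat \<Rightarrow> nat \<Rightarrow> pt \<Rightarrow> complex) \<Rightarrow> pt \<Rightarrow> bool" where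
  "surj_at r s A p \<longleftrightarrow> (\<forall>u. \<exists>v. \<forall>i<s. (\<Sum>j<r. A i j p * v j) = u i)"

definition is_monad :: "nat \<Rightarrow> nat \<Rightarrow> twist list \<Rightarrow> twist list \<Rightarrow> twist list
    \<Rightarrow> (nat \<Rightarrow> nat \<Rightarrow> pt \<Rightarrow> complex) \<Rightarrow> (nat \<Rightarrow> nat \<Rightarrow> pt \<Rightarrow> complex) \<Rightarrow> bool" where
  "is_monad n m L0 L1 L2 \<alpha> \<beta> \<longleftrightarrow>
     is_morphism n m L0 L1 \<alpha> \<and> is_morphism n m L1 L2 \<beta> \<and>
     (\<forall>p. \<forall>i<length L2. \<forall>l<length L0. (\<Sum>j<length L1. \<beta> i j p * \<alpha> j l p) = 0) \<and>
     (\<forall>p. in_X n m p \<longrightarrow> inj_at (length L0) (length L1) \<alpha> p \<and> surj_at (length L1) (length L2) \<beta> p)"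

definition G_n :: "nat \<Rightarrow> nat \<Rightarrow> twist list" where
  "G_n n k = replicate (n + k) (0, -1, 0, 0) @ replicate (n + k) (-1, 0, 0, 0)"

definition G_m :: "nat \<Rightarrow> nat \<Rightarrow> twist list" where
  "G_m m k = replicate (m + k) (0, 0, -1, 0) @ replicate (m + k) (0, 0, 0, -1)"

end

theory Submission
  imports Defs "HOL-Library.FuncSet" "HOL-Analysis.Continuum_Not_Denumerable"
    "HOL-Computational_Algebra.Polynomial_Factorial" "HOL-Computational_Algebra.Field_as_Ring"
begin

text \<open>
Take polynomials \<open>p1, p2\<close> of degree \<open>n\<close> and \<open>p3, p4\<close> of degree \<open>m\<close> in an auxiliary variable,
with generic multilinear forms of multidegrees \<open>(1,0,1,1)\<close>, \<open>(0,1,1,1)\<close>, \<open>(1,1,0,1)\<close>, \<open>(1,1,1,0)\<close>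
as coefficients. The four blocks of \<open>f\<close> are the matrices of multiplication by the \<open>p\<close>'s on
polynomials of degree less than \<open>k\<close>. The map \<open>g\<close> sends \<open>(u1, u2, u3, u4)\<close> to
\<open>\<pi> (p2 u1 - p1 u2) + \<pi>' (p4 u3 - p3 u4)\<close>, where \<open>\<pi>, \<pi>'\<close> are generic matrices of forms of multidegree
\<open>(1,1,0,0)\<close> and \<open>(0,0,1,1)\<close> with \<open>k\<close> rows; then \<open>g f = 0\<close> by commutativity.

Fibrewise injectivity of \<open>f\<close> and surjectivity of \<open>g\<close> follow from a parameter count. All coefficients
of the forms are chosen algebraically independent over the rationals. If \<open>f\<close> or \<open>g\<close> degenerated at
a point, these coefficients would lie in a field generated by fewer elements than there are
coefficients: the ratios of coordinates of the point, the \<open>k - 1\<close> ratios of a linear relation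
between the rows of \<open>g\<close>, few elements describing \<open>p1, p2\<close> and a functional annihilating all
multiples of both (and likewise for \<open>p3, p4\<close>), and those coefficients not determined by these.
\<close>

section \<open>Finitely generated fields and algebraic independence\<close>

text \<open>The subfield generated by \<open>S\<close>. Division is total with
  \<open>inverse 0 = 0\<close>, so inversion is an unconditional rule.\<close>

inductive_set field_gen :: "'a::field set \<Rightarrow> 'a set" for S where
  base: "s \<in> S \<Longrightarrow> s \<in> field_gen S"
| one: "1 \<in> field_gen S"
| add: "a \<in> field_gen S \<Longrightarrow> b \<in> field_gen S \<Longrightarrow> a + b \<in> field_gen S"
| diff: "a \<in> field_gen S \<Longrightarrow> b \<in> field_gen S \<Longrightarrow> a - b \<in> field_gen S"
| mult: "a \<in> field_gen S \<Longrightarrow> b \<in> field_gen S \<Longrightarrow> a * b \<in> field_gen S"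
| inverse: "a \<in> field_gen S \<Longrightarrow> inverse a \<in> field_gen S"

lemma field_gen_zero: "0 \<in> field_gen S"
  using field_gen.diff[OF field_gen.one field_gen.one, of S] by simp

lemma field_gen_uminus: "a \<in> field_gen S \<Longrightarrow> - a \<in> field_gen S"
  using field_gen.diff[OF field_gen_zero, of a S] by simp

lemma field_gen_divide: "a \<in> field_gen S \<Longrightarrow> b \<in> field_gen S \<Longrightarrow> a / b \<in> field_gen S"
  by (simp add: divide_inverse field_gen.mult field_gen.inverse)

lemma field_gen_sum: "(\<And>i. i \<in> I \<Longrightarrow> f i \<in> field_gen S) \<Longrightarrow> sum f I \<in> field_gen S"
  by (induction I rule: infinite_finite_induct) (auto intro: field_gen.add field_gen_zero)

lemma field_gen_power: "a \<in> field_gen S \<Longrightarrow> a ^ j \<in> field_gen S"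
  by (induction j) (auto intro: field_gen.one field_gen.mult)

lemma field_gen_prod: "(\<And>i. i \<in> I \<Longrightarrow> f i \<in> field_gen S) \<Longrightarrow> prod f I \<in> field_gen S"
  by (induction I rule: infinite_finite_induct) (auto intro: field_gen.mult field_gen.one)

lemma field_gen_of_nat: "of_nat j \<in> field_gen S"
  by (induction j) (auto intro: field_gen_zero field_gen.add field_gen.one)

lemma field_gen_of_int: "of_int j \<in> field_gen S"
  by (cases j rule: int_cases2) (auto intro: field_gen_of_nat field_gen_uminus)

lemma field_gen_of_rat: "(of_rat q :: 'a::field_char_0) \<in> field_gen S"
  by (cases q) (auto simp: of_rat_rat intro!: field_gen_divide field_gen_of_int)

lemma field_gen_subset:
  assumes "S \<subseteq> field_gen T" shows "field_gen S \<subseteq> field_gen T"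
proof
  fix x assume "x \<in> field_gen S"
  then show "x \<in> field_gen T"
    by induction (use assms in \<open>auto intro: field_gen.intros\<close>)
qed

lemma field_gen_mono: "S \<subseteq> T \<Longrightarrow> field_gen S \<subseteq> field_gen T"
  by (rule field_gen_subset) (auto intro: field_gen.base)

section \<open>Countability of generated fields and existence of algebraically independent
  families\<close>

datatype field_term = Gen nat | One | Add field_term field_term | Diff field_term field_term
  | Mult field_term field_term | Inv field_term

instance field_term :: countable
  by countable_datatype

primrec field_eval :: "(nat \<Rightarrow> 'a::field) \<Rightarrow> field_term \<Rightarrow> 'a" where
  "field_eval g (Gen i) = g i"
| "field_eval g One = 1"
| "field_eval g (Add a b) = field_eval g a + field_eval g b"
| "field_eval g (Diff a b) = field_eval g a - field_eval g b"
| "field_eval g (Mult a b) = field_eval g a * field_eval g b"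
| "field_eval g (Inv a) = inverse (field_eval g a)"

text \<open>Every element is the value of a formal field expression over an enumeration of
  \<open>S\<close>, and such expressions form a countable type.\<close>

lemma countable_field_gen:
  assumes "countable S" shows "countable (field_gen S)"
proof -
  have "x \<in> range (field_eval (from_nat_into S))" if "x \<in> field_gen S" for x
    using that
  proof induction
    case (base s)
    then obtain i where "from_nat_into S i = s"
      using from_nat_into_surj[OF assms] by blast
    then have "s = field_eval (from_nat_into S) (Gen i)" by simp
    then show ?case by blast
  next
    case one
    have "1 = field_eval (from_nat_into S) One" by simp
    then show ?case by blast
  next
    case (add a b)
    then obtain u v where "a = field_eval (from_nat_into S) u" "b = field_eval (from_nat_into S) v"
      by blast
    then have "a + b = field_eval (from_nat_into S) (Add u v)" by simp
    then show ?case by blast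
  next
    case (diff a b)
    then obtain u v where "a = field_eval (from_nat_into S) u" "b = field_eval (from_nat_into S) v"
      by blast
    then have "a - b = field_eval (from_nat_into S) (Diff u v)" by simp
    then show ?case by blast
  next
    case (mult a b)
    then obtain u v where "a = field_eval (from_nat_into S) u" "b = field_eval (from_nat_into S) v"
      by blast
    then have "a * b = field_eval (from_nat_into S) (Mult u v)" by simp
    then show ?case by blast
  next
    case (inverse a)
    then obtain u where "a = field_eval (from_nat_into S) u" by blast
    then have "inverse a = field_eval (from_nat_into S) (Inv u)" by simp
    then show ?case by blast
  qed
  then have "field_gen S \<subseteq> range (field_eval (from_nat_into S))" by blast
  then show ?thesis by (rule countable_subset) simp
qed

text \<open>Only countably many polynomials have coefficients in \<open>K\<close>, and each nonzero
  one has finitely many roots, so some complex number avoids all of them.\<close>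

lemma exists_transcendental:
  fixes K :: "complex set"
  assumes "countable K"
  shows "\<exists>z. \<forall>p. (\<forall>i. coeff p i \<in> K) \<longrightarrow> poly p z = 0 \<longrightarrow> p = 0"
proof -
  define B where "B = (\<Union>xs\<in>lists K. {z. Poly xs \<noteq> 0 \<and> poly (Poly xs) z = 0})"
  have "countable {z. Poly xs \<noteq> 0 \<and> poly (Poly xs) z = 0}" for xs :: "complex list"
    by (cases "Poly xs = 0") (auto intro!: countable_finite poly_roots_finite)
  then have "countable B"
    unfolding B_def by (intro countable_UN countable_lists assms) auto
  then obtain z where z: "z \<notin> B"
    using uncountable_UNIV_complex by (metis UNIV_eq_I)
  have "p = 0" if "\<forall>i. coeff p i \<in> K" "poly p z = 0" for p
  proof (rule ccontr)
    assume "p \<noteq> 0"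
    moreover have "coeffs p \<in> lists K"
      using that(1) by (auto simp: coeffs_def)
    ultimately have "z \<in> B"
      unfolding B_def using that(2) by (intro UN_I[of "coeffs p"]) auto
    with z show False by simp
  qed
  then show ?thesis by blast
qed

text \<open>For finite \<open>I\<close> this is algebraic independence over the rationals:
  \<open>q\<close> lists the coefficients of a polynomial and \<open>E\<close> bounds its degree in
  each variable. Being a property of the family and not of its range, it excludes repeated
  values.\<close>

definition alg_indep :: "'i set \<Rightarrow> ('i \<Rightarrow> 'a::field_char_0) \<Rightarrow> bool" where
  "alg_indep I c \<longleftrightarrow> (\<forall>E q. (\<Sum>e\<in>I \<rightarrow>\<^sub>E {..E}. of_rat (q e) * (\<Prod>i\<in>I. c i ^ e i)) = 0
     \<longrightarrow> (\<forall>e\<in>I \<rightarrow>\<^sub>E {..E}. q e = (0::rat)))"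

lemma sum_PiE_insert:
  assumes "i \<notin> I"
  shows "(\<Sum>e\<in>insert i I \<rightarrow>\<^sub>E A. h e) = (\<Sum>t\<in>A. \<Sum>e\<in>I \<rightarrow>\<^sub>E A. h (e(i := t)))"
proof -
  have "(\<Sum>e\<in>insert i I \<rightarrow>\<^sub>E A. h e) = (\<Sum>(t, e)\<in>A \<times> (I \<rightarrow>\<^sub>E A). h (e(i := t)))"
    unfolding PiE_insert_eq using inj_combinator[OF assms, of "\<lambda>_. A"]
    by (subst sum.reindex) (auto simp: case_prod_unfold)
  also have "\<dots> = (\<Sum>t\<in>A. \<Sum>e\<in>I \<rightarrow>\<^sub>E A. h (e(i := t)))"
    by (rule sum.cartesian_product[symmetric])
  finally show ?thesis .
qed

text \<open>Adjoin one number at a time, transcendental over the countable field generated by the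
  earlier ones.\<close>

lemma alg_indep_exists:
  assumes "finite I"
  shows "\<exists>c::'i \<Rightarrow> complex. alg_indep I c"
  using assms
proof (induction I)
  case empty
  show ?case by (auto simp: alg_indep_def)
next
  case (insert i I)
  then obtain c :: "'i \<Rightarrow> complex" where c: "alg_indep I c" by blast
  define K where "K = field_gen (c ` I)"
  have "countable K"
    unfolding K_def using insert.hyps(1) by (intro countable_field_gen) (simp add: countable_finite)
  then obtain z where z: "\<And>p. (\<forall>j. coeff p j \<in> K) \<Longrightarrow> poly p z = 0 \<Longrightarrow> p = 0"
    using exists_transcendental by blast
  have "alg_indep (insert i I) (c(i := z))"
    unfolding alg_indep_def
  proof (intro allI impI)
    fix E q
    assume eq: "(\<Sum>e\<in>insert i I \<rightarrow>\<^sub>E {..E}. of_rat (q e) * (\<Prod>j\<in>insert i I. (c(i := z)) j ^ e j)) = 0"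
    \<comment> \<open>The relation is read as a polynomial in the new variable; \<open>a t\<close>
      collects the terms in which that variable has exponent \<open>t\<close>.\<close>
    define a where "a t = (\<Sum>e\<in>I \<rightarrow>\<^sub>E {..E}. of_rat (q (e(i := t))) * (\<Prod>j\<in>I. c j ^ e j))" for t
    define p where "p = (\<Sum>t\<le>E. Polynomial.monom (a t) t)"
    have prodeq: "(\<Prod>j\<in>insert i I. (c(i := z)) j ^ (e(i := t)) j) = z ^ t * (\<Prod>j\<in>I. c j ^ e j)" for e t
    proof -
      have "(\<Prod>j\<in>I. (c(i := z)) j ^ (e(i := t)) j) = (\<Prod>j\<in>I. c j ^ e j)"
        using insert.hyps(2) by (intro prod.cong) auto
      then show ?thesis using insert.hyps by simp
    qed
    have "poly p z = (\<Sum>t\<le>E. a t * z ^ t)"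
      by (simp add: p_def poly_sum poly_monom)
    also have "\<dots> = 0"
      using eq unfolding sum_PiE_insert[OF insert.hyps(2)] prodeq a_def
      by (simp add: sum_distrib_right sum_distrib_left mult_ac)
    finally have "poly p z = 0" .
    moreover have "a t \<in> K" for t
      unfolding a_def K_def
      by (intro field_gen_sum field_gen.mult field_gen_of_rat field_gen_prod field_gen_power field_gen.base) auto
    then have "\<forall>j. coeff p j \<in> K"
      using field_gen_zero by (auto simp: p_def coeff_sum K_def intro!: field_gen_sum)
    ultimately have "p = 0" using z by blast
    have az: "a t = 0" if "t \<le> E" for t
    proof -
      have "coeff p t = a t"
        using that by (simp add: p_def coeff_sum)
      with \<open>p = 0\<close> show ?thesis by simp
    qed
    show "\<forall>e\<in>insert i I \<rightarrow>\<^sub>E {..E}. q e = 0"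
    proof
      fix e assume "e \<in> insert i I \<rightarrow>\<^sub>E {..E}"
      then obtain t e' where e: "e = e'(i := t)" "t \<le> E" "e' \<in> I \<rightarrow>\<^sub>E {..E}"
        unfolding PiE_insert_eq by auto
      then show "q e = 0"
        using c[unfolded alg_indep_def, rule_format, of "\<lambda>e. q (e(i := t))" E] az[OF e(2)]
        unfolding a_def by blast
    qed
  qed
  then show ?case by blast
qed

section \<open>Dimension counts over the rationals\<close>

interpretation rat_space: vector_space "\<lambda>q (z::'a::field_char_0). of_rat q * z"
  by unfold_locales (auto simp: algebra_simps of_rat_add of_rat_mult)

definition monomials :: "'a::field_char_0 set \<Rightarrow> nat \<Rightarrow> 'a set" where
  "monomials S d = (\<lambda>e. \<Prod>s\<in>S. s ^ e s) ` (S \<rightarrow>\<^sub>E {..d})"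

definition poly_span :: "'a::field_char_0 set \<Rightarrow> nat \<Rightarrow> 'a set" where
  "poly_span S d = rat_space.span (monomials S d)"

lemma finite_monomials: "finite S \<Longrightarrow> finite (monomials S d)"
  by (simp add: monomials_def finite_PiE)

lemma card_monomials_le:
  assumes "finite S" shows "card (monomials S d) \<le> (d + 1) ^ card S"
proof -
  have "card (monomials S d) \<le> card (S \<rightarrow>\<^sub>E {..d})"
    unfolding monomials_def by (rule card_image_le) (simp add: assms finite_PiE)
  also have "\<dots> = (d + 1) ^ card S" by (simp add: card_PiE[OF assms])
  finally show ?thesis .
qed

lemma monomials_I: "(\<And>s. s \<in> S \<Longrightarrow> e s \<le> d) \<Longrightarrow> (\<Prod>s\<in>S. s ^ e s) \<in> monomials S d"
  unfolding monomials_def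
  by (rule image_eqI[of _ _ "restrict e S"]) (auto intro!: prod.cong)

lemma poly_span_I: "(\<And>s. s \<in> S \<Longrightarrow> e s \<le> d) \<Longrightarrow> (\<Prod>s\<in>S. s ^ e s) \<in> poly_span S d"
  unfolding poly_span_def by (intro rat_space.span_base monomials_I)

lemma poly_span_mult:
  assumes a: "a \<in> poly_span S d" and b: "b \<in> poly_span S d'"
  shows "a * b \<in> poly_span S (d + d')"
proof -
  have mm: "u * v \<in> poly_span S (d + d')" if "u \<in> monomials S d" "v \<in> monomials S d'" for u v
  proof -
    from that(1) obtain e where e: "e \<in> S \<rightarrow>\<^sub>E {..d}" "u = (\<Prod>s\<in>S. s ^ e s)"
      unfolding monomials_def by (rule imageE)
    from that(2) obtain e' where e': "e' \<in> S \<rightarrow>\<^sub>E {..d'}" "v = (\<Prod>s\<in>S. s ^ e' s)"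
      unfolding monomials_def by (rule imageE)
    have "u * v = (\<Prod>s\<in>S. s ^ (e s + e' s))"
      by (simp add: e(2) e'(2) power_add prod.distrib)
    moreover have "e s + e' s \<le> d + d'" if "s \<in> S" for s
      using e(1) e'(1) that by (intro add_mono) auto
    ultimately show ?thesis by (simp add: poly_span_I)
  qed
  have mb: "u * b \<in> poly_span S (d + d')" if u: "u \<in> monomials S d" for u
    using b unfolding poly_span_def
  proof (induction rule: rat_space.span_induct_alt)
    case base
    show ?case by (simp add: rat_space.span_zero)
  next
    case (step c v y)
    have "u * (of_rat c * v + y) = of_rat c * (u * v) + u * y" by (simp add: algebra_simps)
    then show ?case
      using mm[OF u step(1)] step(2) unfolding poly_span_def
      by (simp add: rat_space.span_add rat_space.span_scale)
  qed
  show ?thesis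
    using a unfolding poly_span_def
  proof (induction rule: rat_space.span_induct_alt)
    case base
    show ?case by (simp add: rat_space.span_zero)
  next
    case (step c v y)
    have "(of_rat c * v + y) * b = of_rat c * (v * b) + y * b" by (simp add: algebra_simps)
    then show ?case
      using mb[OF step(1)] step(2) unfolding poly_span_def
      by (simp add: rat_space.span_add rat_space.span_scale)
  qed
qed

lemma poly_span_one: "1 \<in> poly_span S d"
  using poly_span_I[of S "\<lambda>_. 0" d] by simp

lemma poly_span_add: "a \<in> poly_span S d \<Longrightarrow> b \<in> poly_span S d \<Longrightarrow> a + b \<in> poly_span S d"
  unfolding poly_span_def by (rule rat_space.span_add)

lemma poly_span_diff: "a \<in> poly_span S d \<Longrightarrow> b \<in> poly_span S d \<Longrightarrow> a - b \<in> poly_span S d"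
  unfolding poly_span_def by (rule rat_space.span_diff)

lemma poly_span_power: "a \<in> poly_span S d \<Longrightarrow> a ^ j \<in> poly_span S (j * d)"
  by (induction j) (auto intro: poly_span_one poly_span_mult)

lemma poly_span_prod:
  assumes "finite I" "\<And>i. i \<in> I \<Longrightarrow> f i \<in> poly_span S (d i)"
  shows "prod f I \<in> poly_span S (sum d I)"
  using assms by (induction I) (auto intro: poly_span_one poly_span_mult)

text \<open>Fractions of polynomial expressions are closed under the field operations. One exponent
  bound \<open>d\<close> serves numerator and denominator.\<close>

lemma field_gen_fraction:
  assumes "finite S" "x \<in> field_gen S"
  shows "\<exists>d a b. a \<in> poly_span S d \<and> b \<in> poly_span S d \<and> b \<noteq> 0 \<and> b * x = a"
  using assms(2)
proof induction
  case (base s)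
  have "(\<Prod>t\<in>S. t ^ (if t = s then 1 else 0)) \<in> poly_span S 1"
    by (rule poly_span_I) simp
  moreover have "(\<Prod>t\<in>S. t ^ (if t = s then 1 else 0)) = (\<Prod>t\<in>S. if t = s then t else 1)"
    by (intro prod.cong) auto
  moreover have "\<dots> = s"
    using base assms(1) by (simp add: prod.delta')
  ultimately show ?case
    by (intro exI[of _ 1] exI[of _ s]) (auto intro: poly_span_one)
next
  case one
  show ?case by (intro exI[of _ 0] exI[of _ 1]) (auto intro: poly_span_one)
next
  case (add x y)
  then obtain d a b d' a' b' where h: "a \<in> poly_span S d" "b \<in> poly_span S d" "b \<noteq> 0" "b * x = a"
    "a' \<in> poly_span S d'" "b' \<in> poly_span S d'" "b' \<noteq> 0" "b' * y = a'" by blast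
  have "a * b' + b * a' \<in> poly_span S (d + d')" "b * b' \<in> poly_span S (d + d')"
    using h by (auto intro: poly_span_add poly_span_mult)
  moreover have "b * b' * (x + y) = a * b' + b * a'"
    using h(4,8) by (auto simp: algebra_simps)
  moreover have "b * b' \<noteq> 0" using h by simp
  ultimately show ?case by blast
next
  case (diff x y)
  then obtain d a b d' a' b' where h: "a \<in> poly_span S d" "b \<in> poly_span S d" "b \<noteq> 0" "b * x = a"
    "a' \<in> poly_span S d'" "b' \<in> poly_span S d'" "b' \<noteq> 0" "b' * y = a'" by blast
  have "a * b' - b * a' \<in> poly_span S (d + d')" "b * b' \<in> poly_span S (d + d')"
    using h by (auto intro: poly_span_diff poly_span_mult)
  moreover have "b * b' * (x - y) = a * b' - b * a'"
    using h(4,8) by (auto simp: algebra_simps)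
  moreover have "b * b' \<noteq> 0" using h by simp
  ultimately show ?case by blast
next
  case (mult x y)
  then obtain d a b d' a' b' where h: "a \<in> poly_span S d" "b \<in> poly_span S d" "b \<noteq> 0" "b * x = a"
    "a' \<in> poly_span S d'" "b' \<in> poly_span S d'" "b' \<noteq> 0" "b' * y = a'" by blast
  have "a * a' \<in> poly_span S (d + d')" "b * b' \<in> poly_span S (d + d')"
    using h by (auto intro: poly_span_mult)
  moreover have "b * b' * (x * y) = a * a'"
    using h(4,8) by (auto simp: algebra_simps)
  moreover have "b * b' \<noteq> 0" using h by simp
  ultimately show ?case by blast
next
  case (inverse x)
  then obtain d a b where h: "a \<in> poly_span S d" "b \<in> poly_span S d" "b \<noteq> 0" "b * x = a" by blast
  show ?case
  proof (cases "x = 0")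
    \<comment> \<open>Here the inverse is \<open>0\<close> by convention, represented by the
      fraction with numerator \<open>0\<close> and denominator \<open>b\<close>.\<close>
    case True
    then show ?thesis
      using h by (intro exI[of _ d] exI[of _ 0] exI[of _ b])
        (auto simp: poly_span_def rat_space.span_zero)
  next
    case False
    then have "a \<noteq> 0" "a * inverse x = b" using h by (auto simp: field_simps)
    then show ?thesis using h by blast
  qed
qed

text \<open>Dependence is asserted for the indexed family, so two indices with equal values already
  give a relation; hence the separate non-injective case.\<close>

lemma rat_dependent_of_card:
  fixes f :: "'b \<Rightarrow> 'a::field_char_0"
  assumes "finite X" "finite Y" "card Y < card X" "f ` X \<subseteq> rat_space.span Y"
  shows "\<exists>q. (\<exists>x\<in>X. q x \<noteq> 0) \<and> (\<Sum>x\<in>X. of_rat (q x) * f x) = 0"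
proof (cases "inj_on f X")
  case True
  have "rat_space.dependent (f ` X)"
  proof (rule ccontr)
    assume "\<not> ?thesis"
    from rat_space.independent_span_bound[OF assms(2) this assms(4)] show False
      using assms(3) card_image[OF True] by simp
  qed
  then obtain u where u: "\<exists>v\<in>f ` X. u v \<noteq> 0" "(\<Sum>v\<in>f ` X. of_rat (u v) * v) = 0"
    using rat_space.dependent_finite[of "f ` X"] assms(1) by auto
  then show ?thesis
    by (intro exI[of _ "u \<circ> f"]) (auto simp: sum.reindex[OF True] o_def)
next
  case False
  then obtain x y where xy: "x \<in> X" "y \<in> X" "x \<noteq> y" "f x = f y"
    unfolding inj_on_def by blast
  define q :: "'b \<Rightarrow> rat" where "q z = (if z = x then 1 else if z = y then -1 else 0)" for z
  have "(\<Sum>z\<in>X. of_rat (q z) * f z) = (\<Sum>z\<in>{x, y}. of_rat (q z) * f z)"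
    using xy by (intro sum.mono_neutral_right) (auto simp: assms q_def)
  also have "\<dots> = 0" using xy by (simp add: q_def of_rat_minus)
  finally show ?thesis using xy by (intro exI[of _ q]) (auto simp: q_def)
qed

text \<open>Counting monomials: those of degree at most \<open>E\<close> in each of the \<open>c i\<close> lie, up to a common
denominator, in the span of too few monomials in \<open>S\<close>.\<close>

lemma alg_indep_not_field_gen:
  fixes c :: "'i \<Rightarrow> 'a::field_char_0"
  assumes "finite I" "alg_indep I c" "finite S" "card S < card I"
  shows "\<not> c ` I \<subseteq> field_gen S"
proof
  assume sub: "c ` I \<subseteq> field_gen S"
  have "\<forall>i\<in>I. \<exists>d a b. a \<in> poly_span S d \<and> b \<in> poly_span S d \<and> b \<noteq> 0 \<and> b * c i = a"
    using field_gen_fraction[OF assms(3)] sub by blast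
  then obtain d a b where h: "\<And>i. i \<in> I \<Longrightarrow> a i \<in> poly_span S (d i) \<and> b i \<in> poly_span S (d i) \<and>
      b i \<noteq> 0 \<and> b i * c i = a i"
    by metis
  define D where "D = sum d I"
  define N where "N = card I"
  \<comment> \<open>A common denominator of all \<open>c i\<close>; both \<open>B\<close> and each
    \<open>B * c i\<close> have exponents at most \<open>D\<close>.\<close>
  define B where "B = prod b I"
  have B0: "B \<noteq> 0" unfolding B_def using h assms(1) by auto
  have B: "B \<in> poly_span S D"
    unfolding B_def D_def using h by (intro poly_span_prod assms(1)) auto
  have Bc: "B * c i \<in> poly_span S D" if "i \<in> I" for i
  proof -
    have "B * c i = a i * prod b (I - {i})"
      using h[OF that] assms(1) that by (simp add: B_def prod.remove mult_ac)
    moreover have "a i * prod b (I - {i}) \<in> poly_span S (d i + sum d (I - {i}))"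
      using h that assms(1) by (intro poly_span_mult poly_span_prod) auto
    moreover have "d i + sum d (I - {i}) = D"
      using assms(1) that by (simp add: D_def sum.remove)
    ultimately show ?thesis by simp
  qed
  \<comment> \<open>Chosen so that \<open>(N * D + 1) ^ card S * (E + 1) ^ card S\<close> stays
    below \<open>(E + 1) ^ N\<close>: as \<open>card S < N\<close>, one spare factor
    \<open>E + 1\<close> absorbs the constant.\<close>
  define E where "E = (N * D + 1) ^ card S"
  \<comment> \<open>Each of the \<open>N\<close> factors \<open>c i ^ e i\<close> needs at most
    \<open>E\<close> copies of the denominator.\<close>
  define f where "f e = B ^ (N * E) * (\<Prod>i\<in>I. c i ^ e i)" for e :: "'i \<Rightarrow> nat"
  have f: "f e \<in> poly_span S (N * E * D)" if e: "e \<in> I \<rightarrow>\<^sub>E {..E}" for e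
  proof -
    have "f e = (\<Prod>i\<in>I. B ^ E) * (\<Prod>i\<in>I. c i ^ e i)"
      by (simp add: f_def N_def power_mult mult.commute)
    also have "\<dots> = (\<Prod>i\<in>I. B ^ E * c i ^ e i)"
      by (simp add: prod.distrib)
    also have "\<dots> = (\<Prod>i\<in>I. (B * c i) ^ e i * B ^ (E - e i))"
    proof (rule prod.cong)
      fix i assume "i \<in> I"
      then have "e i \<le> E" using e by auto
      then have "B ^ E = B ^ e i * B ^ (E - e i)" by (simp flip: power_add)
      then show "B ^ E * c i ^ e i = (B * c i) ^ e i * B ^ (E - e i)"
        by (simp add: power_mult_distrib mult_ac)
    qed simp
    also have "\<dots> \<in> poly_span S (\<Sum>i\<in>I. e i * D + (E - e i) * D)"
      by (intro poly_span_prod assms(1) poly_span_mult poly_span_power Bc B)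
    also have "(\<Sum>i\<in>I. e i * D + (E - e i) * D) = (\<Sum>i\<in>I. E * D)"
    proof (rule sum.cong)
      fix i assume "i \<in> I"
      then have "e i \<le> E" using e by auto
      then show "e i * D + (E - e i) * D = E * D" by (simp flip: add_mult_distrib)
    qed simp
    finally show ?thesis by (simp add: N_def mult.assoc)
  qed
  have "card (monomials S (N * E * D)) \<le> (N * E * D + 1) ^ card S"
    by (rule card_monomials_le[OF assms(3)])
  also have "\<dots> \<le> ((N * D + 1) * (E + 1)) ^ card S"
    by (intro power_mono) (auto simp: algebra_simps)
  also have "\<dots> = E * (E + 1) ^ card S"
    by (simp only: power_mult_distrib E_def)
  also have "\<dots> < (E + 1) ^ Suc (card S)" by simp
  also have "\<dots> \<le> (E + 1) ^ N"
    using assms(4) unfolding N_def by (intro power_increasing) auto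
  also have "\<dots> = card (I \<rightarrow>\<^sub>E {..E})"
    by (simp add: card_PiE[OF assms(1)] N_def)
  finally have "card (monomials S (N * E * D)) < card (I \<rightarrow>\<^sub>E {..E})" .
  moreover have "finite (I \<rightarrow>\<^sub>E {..E})" using assms(1) by (simp add: finite_PiE)
  ultimately obtain q where q: "\<exists>e\<in>I \<rightarrow>\<^sub>E {..E}. q e \<noteq> 0"
      "(\<Sum>e\<in>I \<rightarrow>\<^sub>E {..E}. of_rat (q e) * f e) = 0"
    using rat_dependent_of_card[of "I \<rightarrow>\<^sub>E {..E}" "monomials S (N * E * D)" f] f
      finite_monomials[OF assms(3)] unfolding poly_span_def by blast
  have "B ^ (N * E) * (\<Sum>e\<in>I \<rightarrow>\<^sub>E {..E}. of_rat (q e) * (\<Prod>i\<in>I. c i ^ e i)) = 0"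
    using q(2) by (simp add: f_def sum_distrib_left mult_ac)
  then have "(\<Sum>e\<in>I \<rightarrow>\<^sub>E {..E}. of_rat (q e) * (\<Prod>i\<in>I. c i ^ e i)) = 0"
    using B0 by simp
  then show False using assms(2) q(1) unfolding alg_indep_def by blast
qed

section \<open>Functionals annihilating multiples of two polynomials\<close>

text \<open>Here \<open>\<theta>\<close> is read as the linear functional sending the monomial of
  degree \<open>l\<close> to \<open>\<theta> l\<close>; the right side is its value on the
  \<open>i\<close>-th shift of \<open>p\<close>. The condition \<open>N + i \<le> B\<close> keeps
  the truncated sum from losing coefficients.\<close>

lemma sum_coeff_shift:
  fixes p :: "'a::comm_semiring_1 poly"
  assumes "degree p \<le> N" "N + i \<le> B"
  shows "(\<Sum>l\<le>B. coeff (p * Polynomial.monom 1 i) l * \<theta> l) = (\<Sum>j\<le>N. coeff p j * \<theta> (i + j))"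
proof -
  have "(\<Sum>l\<le>B. coeff (p * Polynomial.monom 1 i) l * \<theta> l)
      = (\<Sum>l\<in>(+) i ` {..N}. coeff (p * Polynomial.monom 1 i) l * \<theta> l)"
  proof (rule sum.mono_neutral_right)
    show "\<forall>l\<in>{..B} - (+) i ` {..N}. coeff (p * Polynomial.monom 1 i) l * \<theta> l = 0"
    proof
      fix l assume l: "l \<in> {..B} - (+) i ` {..N}"
      have "coeff p (l - i) = 0" if "i \<le> l"
      proof (rule coeff_eq_0)
        have "l - i > N"
        proof (rule ccontr)
          assume "\<not> N < l - i"
          then have "l \<in> (+) i ` {..N}" using that by (intro image_eqI[of _ _ "l - i"]) auto
          with l show False by simp
        qed
        then show "degree p < l - i" using assms(1) by simp
      qed
      then show "coeff (p * Polynomial.monom 1 i) l * \<theta> l = 0"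
        by (simp add: mult.commute[of p] coeff_monom_mult)
    qed
  qed (use assms in auto)
  also have "\<dots> = (\<Sum>j\<le>N. coeff p j * \<theta> (i + j))"
    by (simp add: sum.reindex mult.commute[of p] coeff_monom_mult)
  finally show ?thesis .
qed

text \<open>The product is a linear combination of the shifts of \<open>p\<close> by at most
  \<open>degree u\<close>, on which the functional vanishes.\<close>

lemma sum_coeff_mult_eq_0:
  fixes p u :: "'a::comm_ring_1 poly"
  assumes "\<And>i. i < M \<Longrightarrow> (\<Sum>l\<le>B. coeff (p * Polynomial.monom 1 i) l * \<theta> l) = 0" "degree u < M"
  shows "(\<Sum>l\<le>B. coeff (p * u) l * \<theta> l) = 0"
proof -
  have "p * u = (\<Sum>i\<le>degree u. smult (coeff u i) (p * Polynomial.monom 1 i))"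
    by (subst (1) poly_as_sum_of_monoms[symmetric, of u])
      (simp add: sum_distrib_left flip: mult_smult_right, simp add: smult_monom)
  then have "(\<Sum>l\<le>B. coeff (p * u) l * \<theta> l)
      = (\<Sum>l\<le>B. \<Sum>i\<le>degree u. coeff u i * (coeff (p * Polynomial.monom 1 i) l * \<theta> l))"
    by (simp add: coeff_sum sum_distrib_right mult.assoc)
  also have "\<dots> = (\<Sum>i\<le>degree u. coeff u i * (\<Sum>l\<le>B. coeff (p * Polynomial.monom 1 i) l * \<theta> l))"
    by (subst sum.swap) (simp add: sum_distrib_left)
  also have "\<dots> = 0"
    using assms by (intro sum.neutral) auto
  finally show ?thesis .
qed

text \<open>A Bezout representation \<open>g c = p s + q r\<close> can be reduced to small degrees by replacing \<open>r\<close>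
with its remainder modulo \<open>p / g\<close>.\<close>

lemma bezout_bounded:
  fixes p q :: "'a::field_gcd poly"
  assumes "p \<noteq> 0" "degree q \<le> degree p" "degree p \<le> M" "M > 0"
    "degree c + degree (gcd p q) < M + degree p"
  shows "\<exists>s r. gcd p q * c = p * s + q * r \<and> degree s < M \<and> degree r < M"
proof -
  define g where "g = gcd p q"
  obtain a where a: "p = g * a" unfolding g_def by (meson dvdE gcd_dvd1)
  obtain b where b: "q = g * b" unfolding g_def by (meson dvdE gcd_dvd2)
  have nz: "g \<noteq> 0" "a \<noteq> 0" using assms(1) a by auto
  obtain s r where sr: "s * p + r * q = g"
    unfolding g_def by (metis bezout_coefficients_fst_snd)
  \<comment> \<open>The part of \<open>r * c\<close> divisible by \<open>a\<close> is moved to the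
    other summand, using \<open>p * b = q * a\<close>.\<close>
  define r' where "r' = (r * c) mod a"
  define s' where "s' = s * c + b * ((r * c) div a)"
  have pb: "p * b = q * a" by (simp add: a b)
  have "p * s' = (s * p) * c + (p * b) * ((r * c) div a)"
    by (simp add: s'_def algebra_simps)
  then have "p * s' + q * r' = (s * p) * c + q * (a * ((r * c) div a) + (r * c) mod a)"
    unfolding pb r'_def by (simp only: distrib_left mult.assoc add.assoc)
  also have "\<dots> = (s * p) * c + q * (r * c)" by (simp only: mult_div_mod_eq)
  also have "\<dots> = (s * p + r * q) * c" by (simp add: algebra_simps)
  finally have eq: "g * c = p * s' + q * r'" by (simp add: sr)
  have dp: "degree p = degree g + degree a" using nz by (simp add: a degree_mult_eq)
  have dr: "r' = 0 \<or> degree r' < degree a"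
    unfolding r'_def using degree_mod_less[OF nz(2)] by blast
  then have drM: "degree r' < M" using dp assms(3,4) by auto
  have ps: "p * s' = g * c - q * r'" using eq by simp
  \<comment> \<open>The degree of \<open>s'\<close> is read off from
    \<open>p * s' = g * c - q * r'\<close>, whose right side has degree below
    \<open>M + degree p\<close>.\<close>
  have ds: "degree s' < M"
  proof (cases "s' = 0")
    case True
    then show ?thesis using assms(4) by simp
  next
    case False
    have "degree (g * c) < M + degree p"
      using degree_mult_le[of g c] assms(5) by (simp add: g_def)
    moreover have "degree (q * r') < M + degree p"
      using degree_mult_le[of q r'] assms(2) drM by linarith
    ultimately have "degree (p * s') < M + degree p"
      unfolding ps by (rule degree_diff_less)
    then show ?thesis using False assms(1) by (simp add: degree_mult_eq)
  qed
  show ?thesis using eq ds drM unfolding g_def by blast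
qed

lemma card_Un_image_le:
  "card (f ` {..<a} \<union> g ` {..<b::nat}) \<le> a + b"
  by (rule order_trans[OF card_Un_le]) (intro add_mono order_trans[OF card_image_le]; simp)

text \<open>The gcd \<open>g\<close> of \<open>p\<close> and \<open>q\<close> costs as many parameters as it saves in the cofactors, and
\<open>\<theta>\<close> satisfies the linear recurrence with characteristic polynomial \<open>g\<close>.\<close>

lemma annihilator_field_gen_aux:
  fixes p q :: "'a::field_gcd poly"
  assumes p0: "p \<noteq> 0" and qp: "degree q \<le> degree p" and pn: "degree p \<le> n" and k: "k > 0"
    and annp: "\<And>i. i < n + k \<Longrightarrow> (\<Sum>l\<le>n. coeff p l * \<theta> (i + l)) = 0"
    and annq: "\<And>i. i < n + k \<Longrightarrow> (\<Sum>l\<le>n. coeff q l * \<theta> (i + l)) = 0"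
  shows "\<exists>S. finite S \<and> card S \<le> 2 * n + 2 \<and> (\<forall>l. coeff p l \<in> field_gen S) \<and>
    (\<forall>l. coeff q l \<in> field_gen S) \<and> (\<forall>l<2 * n + k. \<theta> l \<in> field_gen S)"
proof -
  define g where "g = gcd p q"
  define \<mu> where "\<mu> = degree p"
  define \<nu> where "\<nu> = degree g"
  \<comment> \<open>The largest possible degree of a shift in use, namely
    \<open>n + (n + k - 1)\<close>.\<close>
  define B where "B = 2 * n + k - 1"
  obtain a where a: "p = g * a" unfolding g_def by (meson dvdE gcd_dvd1)
  obtain b where b: "q = g * b" unfolding g_def by (meson dvdE gcd_dvd2)
  have nz: "g \<noteq> 0" "a \<noteq> 0" using p0 a by auto
  have dp: "\<mu> = \<nu> + degree a" using nz by (simp add: a degree_mult_eq \<mu>_def \<nu>_def)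
  have db: "degree b \<le> \<mu> - \<nu>"
  proof (cases "b = 0")
    case False
    then have "degree q = \<nu> + degree b" using nz by (simp add: b degree_mult_eq \<nu>_def)
    then show ?thesis using qp by (simp add: \<mu>_def)
  qed simp
  \<comment> \<open>A normalised gcd is monic: its leading coefficient costs no parameter, and the
    recurrence can be solved for its last term.\<close>
  have lead: "coeff g \<nu> = 1"
  proof -
    have "normalize g = g" by (simp add: g_def)
    moreover have "coeff (normalize g) \<nu> = 1"
      using nz by (simp add: \<nu>_def is_unit_unit_factor dvd_field_iff)
    ultimately show ?thesis by simp
  qed
  have ann: "(\<Sum>l\<le>B. coeff (f * Polynomial.monom 1 i) l * \<theta> l) = 0"
    if "degree f \<le> n" "\<And>i. i < n + k \<Longrightarrow> (\<Sum>l\<le>n. coeff f l * \<theta> (i + l)) = 0" "i < n + k" for f i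
    using sum_coeff_shift[of f n i B \<theta>] that by (simp add: B_def)
  \<comment> \<open>The relations for \<open>g\<close> reach \<open>\<mu> - \<nu>\<close> shifts
    further than those for \<open>p\<close> and \<open>q\<close>, because the Bezout bound only
    requires \<open>i + \<nu> < n + k + \<mu>\<close>.\<close>
  have gann: "(\<Sum>j\<le>\<nu>. coeff g j * \<theta> (i + j)) = 0" if i: "i < n + k + (\<mu> - \<nu>)" for i
  proof -
    have "degree (Polynomial.monom (1::'a) i) + degree g < n + k + degree p"
      using i dp by (simp add: degree_monom_eq \<mu>_def \<nu>_def)
    then obtain s r where sr: "g * Polynomial.monom 1 i = p * s + q * r" "degree s < n + k" "degree r < n + k"
      using bezout_bounded[OF p0 qp, of "n + k" "Polynomial.monom 1 i"] pn k unfolding g_def by auto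
    have "(\<Sum>l\<le>B. coeff (p * s) l * \<theta> l) = 0"
      by (rule sum_coeff_mult_eq_0[OF ann[OF pn annp] sr(2)])
    moreover have "(\<Sum>l\<le>B. coeff (q * r) l * \<theta> l) = 0"
      using qp pn by (intro sum_coeff_mult_eq_0[OF ann[OF _ annq] sr(3)]) auto
    ultimately have "(\<Sum>l\<le>B. coeff (g * Polynomial.monom 1 i) l * \<theta> l) = 0"
      unfolding sr(1) by (simp add: distrib_right sum.distrib)
    moreover have "\<nu> + i \<le> B" using i dp pn k by (simp add: B_def \<mu>_def)
    ultimately show ?thesis
      using sum_coeff_shift[of g \<nu> i B \<theta>] by (simp add: \<nu>_def)
  qed
  \<comment> \<open>Parameters: the two cofactors, the non-leading coefficients of \<open>g\<close>,
    \<open>\<nu>\<close> initial values of the recurrence, and the \<open>n - \<mu>\<close> entries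
    of \<open>\<theta>\<close> beyond its reach. They number at most
    \<open>n + \<mu> + 2\<close>.\<close>
  define S where "S = (coeff a ` {..<\<mu> - \<nu> + 1} \<union> coeff b ` {..<\<mu> - \<nu> + 1}) \<union>
    ((coeff g ` {..<\<nu>} \<union> \<theta> ` {..<\<nu>}) \<union> \<theta> ` {n + k + \<mu>..<2 * n + k})"
  have "card (\<theta> ` {n + k + \<mu>..<2 * n + k}) \<le> n - \<mu>"
    by (rule order_trans[OF card_image_le]) auto
  then have "card S \<le> ((\<mu> - \<nu> + 1) + (\<mu> - \<nu> + 1)) + ((\<nu> + \<nu>) + (n - \<mu>))"
    unfolding S_def
    by (intro order_trans[OF card_Un_le] add_mono card_Un_image_le) auto
  also have "\<dots> \<le> 2 * n + 2" using dp pn by (simp add: \<mu>_def)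
  finally have card: "card S \<le> 2 * n + 2" .
  have low: "coeff f l \<in> field_gen S" if "coeff f ` {..<d + 1} \<subseteq> S" "degree f \<le> d" for f d l
  proof (cases "l \<le> d")
    case True
    then show ?thesis using that by (auto intro!: field_gen.base)
  next
    case False
    then show ?thesis using that by (simp add: coeff_eq_0 field_gen_zero)
  qed
  have aS: "coeff a l \<in> field_gen S" for l
    by (rule low[of a "\<mu> - \<nu>"]) (auto simp: S_def dp)
  have bS: "coeff b l \<in> field_gen S" for l
    by (rule low[of b "\<mu> - \<nu>"]) (auto simp: S_def db)
  have gS: "coeff g l \<in> field_gen S" for l
  proof -
    consider "l < \<nu>" | "l = \<nu>" | "l > \<nu>" by linarith
    then show ?thesis
    proof cases
      case 1
      then show ?thesis by (auto simp: S_def intro!: field_gen.base)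
    next
      case 2
      then show ?thesis by (simp add: lead field_gen.one)
    next
      case 3
      then show ?thesis by (simp add: coeff_eq_0 \<nu>_def field_gen_zero)
    qed
  qed
  have "\<theta> l \<in> field_gen S" if "l < 2 * n + k" for l
    using that
  proof (induction l rule: less_induct)
    case (less l)
    show ?case
    proof (cases "l < \<nu> \<or> n + k + \<mu> \<le> l")
      case True
      then show ?thesis using less.prems by (auto simp: S_def intro!: field_gen.base)
    next
      case False
      define i where "i = l - \<nu>"
      have i: "l = i + \<nu>" "i < n + k + (\<mu> - \<nu>)" using False dp by (auto simp: i_def)
      have "0 = (\<Sum>j<Suc \<nu>. coeff g j * \<theta> (i + j))"
        using gann[OF i(2)] by (simp add: lessThan_Suc_atMost)
      then have "\<theta> l = - (\<Sum>j<\<nu>. coeff g j * \<theta> (i + j))"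
        by (simp add: i(1) lead add_eq_0_iff)
      moreover have "\<theta> (i + j) \<in> field_gen S" if "j < \<nu>" for j
        using less that by (simp add: i(1))
      ultimately show ?thesis
        by (auto intro!: field_gen_uminus field_gen_sum field_gen.mult gS)
    qed
  qed
  moreover have "finite S" by (simp add: S_def)
  moreover have "coeff p l \<in> field_gen S" "coeff q l \<in> field_gen S" for l
    unfolding a b by (auto simp: coeff_mult intro!: field_gen_sum field_gen.mult aS bS gS)
  ultimately show ?thesis using card by blast
qed

text \<open>The bound is free of \<open>k\<close>: the polynomials together with the
  \<open>2 * n + k\<close> entries of \<open>\<theta>\<close> cost no more than the
  \<open>2 * n + 2\<close> coefficients of two polynomials alone. The final count rests on this
  saving.\<close>

lemma annihilator_field_gen:
  fixes p q \<theta> :: "nat \<Rightarrow> 'a::field_gcd"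
  assumes nz: "\<exists>l\<le>n. p l \<noteq> 0 \<or> q l \<noteq> 0" and k: "k > 0"
    and ann: "\<And>i. i < n + k \<Longrightarrow> (\<Sum>l\<le>n. p l * \<theta> (i + l)) = 0"
      "\<And>i. i < n + k \<Longrightarrow> (\<Sum>l\<le>n. q l * \<theta> (i + l)) = 0"
  shows "\<exists>S. finite S \<and> card S \<le> 2 * n + 2 \<and> (\<forall>l\<le>n. p l \<in> field_gen S) \<and>
    (\<forall>l\<le>n. q l \<in> field_gen S) \<and> (\<forall>l<2 * n + k. \<theta> l \<in> field_gen S)"
proof -
  define P where "P f = (\<Sum>l\<le>n. Polynomial.monom (f l) l)" for f :: "nat \<Rightarrow> 'a"
  have coeff: "coeff (P f) l = f l" if "l \<le> n" for f l
    using that by (simp add: P_def coeff_sum)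
  have deg: "degree (P f) \<le> n" for f
    unfolding P_def by (intro degree_sum_le order_trans[OF degree_monom_le]) auto
  have annP: "(\<Sum>l\<le>n. coeff (P p) l * \<theta> (i + l)) = 0" "(\<Sum>l\<le>n. coeff (P q) l * \<theta> (i + l)) = 0"
    if "i < n + k" for i
    using ann that by (simp_all add: coeff)
  have nzP: "P p \<noteq> 0 \<or> P q \<noteq> 0" using nz coeff by (metis coeff_0)
  have "\<exists>S. finite S \<and> card S \<le> 2 * n + 2 \<and> (\<forall>l. coeff (P p) l \<in> field_gen S) \<and>
    (\<forall>l. coeff (P q) l \<in> field_gen S) \<and> (\<forall>l<2 * n + k. \<theta> l \<in> field_gen S)"
  \<comment> \<open>The auxiliary lemma takes a nonzero polynomial of larger or equal degree first;
    the two are exchanged if necessary.\<close>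
  proof (cases "P q = 0 \<or> P p \<noteq> 0 \<and> degree (P q) \<le> degree (P p)")
    case True
    then show ?thesis
      using annihilator_field_gen_aux[of "P p" "P q" n k \<theta>] nzP deg k annP by auto
  next
    case False
    then have "degree (P p) \<le> degree (P q)" by (cases "P p = 0") auto
    with False show ?thesis
      using annihilator_field_gen_aux[of "P q" "P p" n k \<theta>] deg k annP by auto
  qed
  then show ?thesis by (metis coeff)
qed

section \<open>Matrices over a field\<close>

text \<open>Induction in the manner of Gram-Schmidt: a vector \<open>w\<close> that kills the old
  rows and pairs to one with the new row corrects the vectors dual to the old rows.\<close>

lemma rows_dual_basis:
  fixes A :: "nat \<Rightarrow> nat \<Rightarrow> 'a::field"
  assumes "\<And>c. (\<forall>j<r. (\<Sum>i<s. c i * A i j) = 0) \<Longrightarrow> \<forall>i<s. c i = 0"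
  shows "\<exists>e. \<forall>i<s. \<forall>i'<s. (\<Sum>j<r. A i j * e i' j) = (if i = i' then 1 else 0)"
  using assms
proof (induction s)
  case 0
  show ?case by simp
next
  case (Suc s)
  have "\<forall>i<s. c i = 0" if "\<forall>j<r. (\<Sum>i<s. c i * A i j) = 0" for c
  proof -
    have "(\<Sum>i<s. (c(s := 0)) i * A i j) = (\<Sum>i<s. c i * A i j)" for j
      by (intro sum.cong) auto
    then have "\<forall>i<Suc s. (c(s := 0)) i = 0"
      using that by (intro Suc.prems) simp
    then show ?thesis by (metis fun_upd_other less_Suc_eq nat_neq_iff)
  qed
  then obtain e where e: "\<And>i i'. i < s \<Longrightarrow> i' < s \<Longrightarrow> (\<Sum>j<r. A i j * e i' j) = (if i = i' then 1 else 0)"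
    using Suc.IH by blast
  define \<alpha> where "\<alpha> i = (\<Sum>j<r. A s j * e i j)" for i
  \<comment> \<open>The new row minus the combination of old rows that has the same pairings with
    all \<open>e i\<close>; independence keeps it nonzero.\<close>
  define \<rho> where "\<rho> j = A s j - (\<Sum>i<s. \<alpha> i * A i j)" for j
  have "\<exists>j0<r. \<rho> j0 \<noteq> 0"
  proof (rule ccontr)
    assume "\<not> ?thesis"
    then have z: "\<rho> j = 0" if "j < r" for j using that by blast
    define c where "c i = (if i = s then 1 else - \<alpha> i)" for i
    have "(\<Sum>i<Suc s. c i * A i j) = \<rho> j" for j
      by (simp add: c_def \<rho>_def sum_negf)
    then have "\<forall>i<Suc s. c i = 0" using z by (intro Suc.prems) simp
    then show False by (auto simp: c_def)
  qed
  then obtain j0 where j0: "j0 < r" "\<rho> j0 \<noteq> 0" by blast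
  \<comment> \<open>The \<open>j0\<close>-th unit vector, corrected by the \<open>e i\<close> so as
    to kill the old rows. It then pairs to \<open>\<rho> j0\<close> with the new row, whence the
    division.\<close>
  define w where "w j = ((if j = j0 then 1 else 0) - (\<Sum>i<s. A i j0 * e i j)) / \<rho> j0" for j
  have Aw: "(\<Sum>j<r. A i j * w j) = (A i j0 - (\<Sum>i'<s. A i' j0 * (\<Sum>j<r. A i j * e i' j))) / \<rho> j0" for i
  proof -
    have "(\<Sum>j<r. A i j * w j)
        = ((\<Sum>j<r. A i j * (if j = j0 then 1 else 0)) - (\<Sum>j<r. \<Sum>i'<s. A i' j0 * (A i j * e i' j))) / \<rho> j0"
      unfolding w_def sum_divide_distrib[symmetric] times_divide_eq_right right_diff_distrib sum_subtractf
      by (simp add: sum_distrib_left mult_ac)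
    also have "(\<Sum>j<r. \<Sum>i'<s. A i' j0 * (A i j * e i' j)) = (\<Sum>i'<s. A i' j0 * (\<Sum>j<r. A i j * e i' j))"
      by (subst sum.swap) (simp add: sum_distrib_left)
    also have "(\<Sum>j<r. A i j * (if j = j0 then 1 else 0)) = (\<Sum>j<r. if j = j0 then A i j else 0)"
      by (intro sum.cong) auto
    finally show ?thesis using j0(1) by simp
  qed
  have w0: "(\<Sum>j<r. A i j * w j) = 0" if "i < s" for i
  proof -
    have "(\<Sum>i'<s. A i' j0 * (\<Sum>j<r. A i j * e i' j)) = (\<Sum>i'<s. if i' = i then A i' j0 else 0)"
      using e that by (intro sum.cong) auto
    then show ?thesis using that by (simp add: Aw)
  qed
  have w1: "(\<Sum>j<r. A s j * w j) = 1"
    using j0(2) unfolding Aw \<alpha>_def[symmetric] by (simp add: \<rho>_def mult.commute)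
  define e' where "e' i j = (if i = s then w j else e i j - \<alpha> i * w j)" for i j
  have e': "(\<Sum>j<r. A i j * e' i' j) = (if i' = s then \<Sum>j<r. A i j * w j
      else (\<Sum>j<r. A i j * e i' j) - \<alpha> i' * (\<Sum>j<r. A i j * w j))" for i i'
    by (simp add: e'_def right_diff_distrib sum_subtractf sum_distrib_left mult_ac)
  have "(\<Sum>j<r. A i j * e' i' j) = (if i = i' then 1 else 0)" if "i < Suc s" "i' < Suc s" for i i'
  proof (cases "i = s")
    case True
    then show ?thesis using that w1 by (auto simp: e' \<alpha>_def)
  next
    case False
    then show ?thesis using that by (auto simp: e' w0 e)
  qed
  then show ?case by blast
qed

lemma rows_independent_onto:
  fixes A :: "nat \<Rightarrow> nat \<Rightarrow> 'a::field"
  assumes "\<And>c. (\<forall>j<r. (\<Sum>i<s. c i * A i j) = 0) \<Longrightarrow> \<forall>i<s. c i = 0"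
  shows "\<exists>v. \<forall>i<s. (\<Sum>j<r. A i j * v j) = u i"
proof -
  obtain e where e: "\<forall>i<s. \<forall>i'<s. (\<Sum>j<r. A i j * e i' j) = (if i = i' then 1 else 0)"
    using rows_dual_basis[OF assms] by blast
  have "(\<Sum>j<r. A i j * (\<Sum>i'<s. u i' * e i' j)) = u i" if "i < s" for i
  proof -
    have "(\<Sum>j<r. A i j * (\<Sum>i'<s. u i' * e i' j)) = (\<Sum>i'<s. u i' * (\<Sum>j<r. A i j * e i' j))"
      unfolding sum_distrib_left by (subst sum.swap) (simp add: mult_ac)
    also have "\<dots> = (\<Sum>i'<s. if i' = i then u i' else 0)"
      using e that by (intro sum.cong) auto
    also have "\<dots> = u i" using that by simp
    finally show ?thesis .
  qed
  then show ?thesis by (intro exI[of _ "\<lambda>j. \<Sum>i'<s. u i' * e i' j"]) simp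
qed

section \<open>Toeplitz matrices of multiplication by a polynomial\<close>

lemma sum_toeplitz_column:
  fixes h p :: "nat \<Rightarrow> 'a::semiring_0"
  assumes "j < k"
  shows "(\<Sum>i<n + k. h i * (if j \<le> i \<and> i - j \<le> n then p (i - j) else 0)) = (\<Sum>r\<le>n. h (j + r) * p r)"
proof -
  have "(\<Sum>i<n + k. h i * (if j \<le> i \<and> i - j \<le> n then p (i - j) else 0))
      = (\<Sum>i\<in>(+) j ` {..n}. h i * (if j \<le> i \<and> i - j \<le> n then p (i - j) else 0))"
  proof (rule sum.mono_neutral_right)
    have "i \<in> (+) j ` {..n}" if "j \<le> i" "i - j \<le> n" for i
      using that by (intro image_eqI[of _ _ "i - j"]) auto
    then show "\<forall>i\<in>{..<n + k} - (+) j ` {..n}. h i * (if j \<le> i \<and> i - j \<le> n then p (i - j) else 0) = 0"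
      by auto
  qed (use assms in auto)
  then show ?thesis by (simp add: sum.reindex)
qed

text \<open>Multiplication by a nonzero polynomial is injective: its lowest nonzero coefficient
  \<open>p s\<close> makes the system triangular.\<close>

lemma toeplitz_injective:
  fixes p v :: "nat \<Rightarrow> 'a::idom"
  assumes nz: "r \<le> n" "p r \<noteq> 0"
    and eq: "\<And>i. i < n + k \<Longrightarrow> (\<Sum>j<k. (if j \<le> i \<and> i - j \<le> n then p (i - j) else 0) * v j) = 0"
  shows "\<forall>j<k. v j = 0"
proof -
  define s where "s = (LEAST r. p r \<noteq> 0)"
  have s: "p s \<noteq> 0" "s \<le> n" "\<And>i. i < s \<Longrightarrow> p i = 0"
    using nz LeastI[of "\<lambda>r. p r \<noteq> 0" r] Least_le[of "\<lambda>r. p r \<noteq> 0" r] not_less_Least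
    unfolding s_def by (force intro: order_trans)+
  have "v j = 0" if "j < k" for j
    using that
  proof (induction j rule: less_induct)
    case (less j)
    \<comment> \<open>In row \<open>j + s\<close> the earlier unknowns vanish by induction, and the
      later ones meet coefficients of \<open>p\<close> below index \<open>s\<close>.\<close>
    have "(\<Sum>j'<k. (if j' \<le> j + s \<and> j + s - j' \<le> n then p (j + s - j') else 0) * v j')
        = (\<Sum>j'\<in>{j}. (if j' \<le> j + s \<and> j + s - j' \<le> n then p (j + s - j') else 0) * v j')"
    proof (rule sum.mono_neutral_right)
      show "\<forall>j'\<in>{..<k} - {j}. (if j' \<le> j + s \<and> j + s - j' \<le> n then p (j + s - j') else 0) * v j' = 0"
      proof
        fix j' assume "j' \<in> {..<k} - {j}"
        then consider "j' < j" "j' < k" | "j < j'" by force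
        then show "(if j' \<le> j + s \<and> j + s - j' \<le> n then p (j + s - j') else 0) * v j' = 0"
          by cases (use less.IH s(3) in auto)
      qed
    qed (use less.prems in auto)
    then have "p s * v j = 0"
      using eq[of "j + s"] less.prems s(2) by simp
    then show ?case using s(1) by simp
  qed
  then show ?thesis by blast
qed

lemma sum_lessThan_add:
  fixes h :: "nat \<Rightarrow> 'a::comm_monoid_add"
  shows "(\<Sum>i<a + b. h i) = (\<Sum>i<a. h i) + (\<Sum>i<b. h (a + i))"
  by (induction b) (simp_all add: add.assoc)

section \<open>Multihomogeneous forms\<close>

lemma finite_exps: "finite (exps N d)"
proof (rule finite_subset)
  show "exps N d \<subseteq> {e. \<forall>i. (i \<in> {..N} \<longrightarrow> e i \<in> {..nat d}) \<and> (i \<notin> {..N} \<longrightarrow> e i = 0)}"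
  proof (clarsimp simp: exps_def)
    fix e :: "nat \<Rightarrow> nat" and i
    assume "i \<le> N"
    then have "e i \<le> (\<Sum>i\<le>N. e i)" by (intro member_le_sum) auto
    then show "e i \<le> nat (\<Sum>i\<le>N. int (e i))" by (simp flip: of_nat_sum)
  qed
qed (intro finite_set_of_finite_funs; simp)

text \<open>Packing the four exponent vectors into one tuple turns the fourfold sum in
  \<open>multihom\<close> into a single one.\<close>

definition exps4 :: "nat \<Rightarrow> nat \<Rightarrow> twist \<Rightarrow> ((nat \<Rightarrow> nat) \<times> (nat \<Rightarrow> nat) \<times> (nat \<Rightarrow> nat) \<times> (nat \<Rightarrow> nat)) set" where
  "exps4 n m t = (case t of (a, b, c, d) \<Rightarrow> exps n a \<times> exps n b \<times> exps m c \<times> exps m d)"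

definition monom4 :: "nat \<Rightarrow> nat \<Rightarrow> (nat \<Rightarrow> nat) \<times> (nat \<Rightarrow> nat) \<times> (nat \<Rightarrow> nat) \<times> (nat \<Rightarrow> nat) \<Rightarrow> pt \<Rightarrow> complex" where
  "monom4 n m e p = (case e of (e1, e2, e3, e4) \<Rightarrow> case p of (x, y, z, w) \<Rightarrow>
     Defs.monom n e1 x * Defs.monom n e2 y * Defs.monom m e3 z * Defs.monom m e4 w)"

lemma multihom_iff:
  "multihom n m t F \<longleftrightarrow> (\<exists>C. \<forall>p. F p = (\<Sum>e\<in>exps4 n m t. C e * monom4 n m e p))"
proof -
  obtain a b c d where t: "t = (a, b, c, d)" by (cases t)
  have eq: "(\<Sum>e\<in>exps4 n m t. C e * monom4 n m e (x, y, z, w))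
      = (\<Sum>e1\<in>exps n a. \<Sum>e2\<in>exps n b. \<Sum>e3\<in>exps m c. \<Sum>e4\<in>exps m d.
           C (e1, e2, e3, e4) * Defs.monom n e1 x * Defs.monom n e2 y * Defs.monom m e3 z * Defs.monom m e4 w)"
    for C x y z w
    unfolding exps4_def t by (simp add: monom4_def sum.cartesian_product case_prod_unfold mult.assoc)
  show ?thesis
  proof
    assume "multihom n m t F"
    then obtain C where C: "\<And>x y z w. F (x, y, z, w) =
        (\<Sum>e1\<in>exps n a. \<Sum>e2\<in>exps n b. \<Sum>e3\<in>exps m c. \<Sum>e4\<in>exps m d.
           C e1 e2 e3 e4 * Defs.monom n e1 x * Defs.monom n e2 y * Defs.monom m e3 z * Defs.monom m e4 w)"
      unfolding multihom_def t by auto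
    show "\<exists>C. \<forall>p. F p = (\<Sum>e\<in>exps4 n m t. C e * monom4 n m e p)"
      by (rule exI[of _ "\<lambda>(e1, e2, e3, e4). C e1 e2 e3 e4"]) (auto simp: eq C)
  next
    assume "\<exists>C. \<forall>p. F p = (\<Sum>e\<in>exps4 n m t. C e * monom4 n m e p)"
    then obtain C where C: "\<And>p. F p = (\<Sum>e\<in>exps4 n m t. C e * monom4 n m e p)" by blast
    show "multihom n m t F"
      unfolding multihom_def t case_prod_conv
      by (rule exI[of _ "\<lambda>e1 e2 e3 e4. C (e1, e2, e3, e4)"]) (simp add: C eq)
  qed
qed

lemma finite_exps4: "finite (exps4 n m t)"
  by (cases t) (simp add: exps4_def finite_exps)

lemma multihom_monom4:
  assumes "e \<in> exps4 n m t"
  shows "multihom n m t (monom4 n m e)"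
proof -
  have "(\<Sum>e'\<in>exps4 n m t. (if e' = e then 1 else 0) * monom4 n m e' p) = monom4 n m e p" for p
  proof -
    have "(\<Sum>e'\<in>exps4 n m t. (if e' = e then 1 else 0) * monom4 n m e' p)
        = (\<Sum>e'\<in>exps4 n m t. if e' = e then monom4 n m e' p else 0)"
      by (intro sum.cong) auto
    then show ?thesis using assms by (simp add: finite_exps4)
  qed
  then show ?thesis
    unfolding multihom_iff by (intro exI[of _ "\<lambda>e'. if e' = e then 1 else 0"]) simp
qed

lemma multihom_cmult: "multihom n m t F \<Longrightarrow> multihom n m t (\<lambda>p. c * F p)"
proof -
  assume "multihom n m t F"
  then obtain C where C: "\<And>p. F p = (\<Sum>e\<in>exps4 n m t. C e * monom4 n m e p)"
    unfolding multihom_iff by blast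
  show ?thesis
    unfolding multihom_iff
    by (rule exI[of _ "\<lambda>e. c * C e"]) (simp add: C sum_distrib_left mult.assoc)
qed

lemma multihom_zero: "multihom n m t (\<lambda>p. 0)"
  unfolding multihom_iff by (rule exI[of _ "\<lambda>e. 0"]) simp

lemma multihom_add:
  assumes "multihom n m t F" "multihom n m t G"
  shows "multihom n m t (\<lambda>p. F p + G p)"
proof -
  obtain C where C: "\<And>p. F p = (\<Sum>e\<in>exps4 n m t. C e * monom4 n m e p)"
    using assms(1) unfolding multihom_iff by blast
  obtain D where D: "\<And>p. G p = (\<Sum>e\<in>exps4 n m t. D e * monom4 n m e p)"
    using assms(2) unfolding multihom_iff by blast
  show ?thesis
    unfolding multihom_iff
    by (rule exI[of _ "\<lambda>e. C e + D e"]) (simp add: C D sum.distrib distrib_right)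
qed

lemma multihom_uminus: "multihom n m t F \<Longrightarrow> multihom n m t (\<lambda>p. - F p)"
  using multihom_cmult[of n m t F "-1"] by simp

lemma multihom_sum:
  "(\<And>i. i \<in> I \<Longrightarrow> multihom n m t (F i)) \<Longrightarrow> multihom n m t (\<lambda>p. \<Sum>i\<in>I. F i p)"
  by (induction I rule: infinite_finite_induct) (auto intro: multihom_add multihom_zero)

lemma exps_add: "e \<in> exps N a \<Longrightarrow> e' \<in> exps N b \<Longrightarrow> (\<lambda>i. e i + e' i) \<in> exps N (a + b)"
  by (auto simp: exps_def sum.distrib)

lemma multihom_mult:
  assumes F: "multihom n m (a, b, c, d) F" and G: "multihom n m (a', b', c', d') G"
  shows "multihom n m (a + a', b + b', c + c', d + d') (\<lambda>p. F p * G p)"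
proof -
  obtain C where C: "\<And>p. F p = (\<Sum>e\<in>exps4 n m (a, b, c, d). C e * monom4 n m e p)"
    using F unfolding multihom_iff by blast
  obtain D where D: "\<And>p. G p = (\<Sum>e\<in>exps4 n m (a', b', c', d'). D e * monom4 n m e p)"
    using G unfolding multihom_iff by blast
  have mono: "multihom n m (a + a', b + b', c + c', d + d') (\<lambda>p. monom4 n m e p * monom4 n m e' p)"
    if e: "e \<in> exps4 n m (a, b, c, d)" "e' \<in> exps4 n m (a', b', c', d')" for e e'
  proof -
    obtain e1 e2 e3 e4 where ee: "e = (e1, e2, e3, e4)" by (cases e)
    obtain f1 f2 f3 f4 where ff: "e' = (f1, f2, f3, f4)" by (cases e')
    let ?s = "(\<lambda>i. e1 i + f1 i, \<lambda>i. e2 i + f2 i, \<lambda>i. e3 i + f3 i, \<lambda>i. e4 i + f4 i)"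
    have "(\<lambda>p. monom4 n m e p * monom4 n m e' p) = monom4 n m ?s"
      by (auto simp: monom4_def ee ff Defs.monom_def power_add prod.distrib)
    moreover have "?s \<in> exps4 n m (a + a', b + b', c + c', d + d')"
      using e by (simp add: exps4_def ee ff exps_add)
    ultimately show ?thesis by (simp add: multihom_monom4)
  qed
  have "(\<lambda>p. F p * G p) = (\<lambda>p. \<Sum>e\<in>exps4 n m (a, b, c, d). \<Sum>e'\<in>exps4 n m (a', b', c', d').
      (C e * D e') * (monom4 n m e p * monom4 n m e' p))"
    by (simp add: C D sum_product mult_ac)
  then show ?thesis
    by (simp only:) (intro multihom_sum multihom_cmult mono)
qed

lemma zero_in_exps: "(\<lambda>_. 0) \<in> exps N 0"
  by (simp add: exps_def)

lemma unit_in_exps: "i \<le> N \<Longrightarrow> (\<lambda>j. if j = i then 1 else 0) \<in> exps N 1"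
  by (auto simp: exps_def simp del: of_nat_sum)

lemma monom_zero: "Defs.monom N (\<lambda>_. 0) x = 1"
  by (simp add: Defs.monom_def)

lemma monom_unit: "i \<le> N \<Longrightarrow> Defs.monom N (\<lambda>j. if j = i then 1 else 0) x = x i"
proof -
  assume "i \<le> N"
  moreover have "Defs.monom N (\<lambda>j. if j = i then 1 else 0) x = (\<Prod>j\<le>N. if j = i then x j else 1)"
    unfolding Defs.monom_def by (intro prod.cong) auto
  ultimately show ?thesis by simp
qed

section \<open>Multilinear monomials, of degree zero or one in each factor\<close>

type_synonym mdeg = "bool \<times> bool \<times> bool \<times> bool"

type_synonym midx = "nat \<times> nat \<times> nat \<times> nat"

text \<open>The singleton in a factor of degree zero gives every monomial exactly one index, hence
  one generic coefficient.\<close>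

definition multilin_idx :: "nat \<Rightarrow> nat \<Rightarrow> mdeg \<Rightarrow> midx set" where
  "multilin_idx n m t = (case t of (t1, t2, t3, t4) \<Rightarrow>
     (if t1 then {..n} else {0}) \<times> (if t2 then {..n} else {0}) \<times>
     (if t3 then {..m} else {0}) \<times> (if t4 then {..m} else {0}))"

definition multilin :: "mdeg \<Rightarrow> midx \<Rightarrow> pt \<Rightarrow> complex" where
  "multilin t \<mu> p = (case t of (t1, t2, t3, t4) \<Rightarrow> case \<mu> of (a, b, c, d) \<Rightarrow> case p of (x, y, z, w) \<Rightarrow>
     (if t1 then x a else 1) * (if t2 then y b else 1) *
     (if t3 then z c else 1) * (if t4 then w d else 1))"

lemma finite_multilin_idx: "finite (multilin_idx n m t)"
  by (cases t) (simp add: multilin_idx_def)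

lemma multihom_multilin:
  assumes "\<mu> \<in> multilin_idx n m (t1, t2, t3, t4)"
  shows "multihom n m (of_bool t1, of_bool t2, of_bool t3, of_bool t4) (multilin (t1, t2, t3, t4) \<mu>)"
proof -
  obtain a b c d where \<mu>: "\<mu> = (a, b, c, d)" by (cases \<mu>)
  define e :: "bool \<Rightarrow> nat \<Rightarrow> nat \<Rightarrow> nat"
    where "e t i = (if t then \<lambda>j. if j = i then 1 else 0 else (\<lambda>_. 0))" for t i
  have ex: "e t i \<in> exps N (of_bool t)" if "t \<Longrightarrow> i \<le> N" for t i N
    using that by (simp add: e_def unit_in_exps zero_in_exps)
  have mo: "Defs.monom N (e t i) x = (if t then x i else 1)" if "t \<Longrightarrow> i \<le> N" for t i N x
    using that by (simp add: e_def monom_unit monom_zero)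
  have le: "t1 \<Longrightarrow> a \<le> n" "t2 \<Longrightarrow> b \<le> n" "t3 \<Longrightarrow> c \<le> m" "t4 \<Longrightarrow> d \<le> m"
    using assms by (auto simp: multilin_idx_def \<mu>)
  have "multilin (t1, t2, t3, t4) \<mu> = monom4 n m (e t1 a, e t2 b, e t3 c, e t4 d)"
    by (auto simp: multilin_def monom4_def \<mu> mo le)
  moreover have "(e t1 a, e t2 b, e t3 c, e t4 d)
      \<in> exps4 n m (of_bool t1, of_bool t2, of_bool t3, of_bool t4)"
    by (simp add: exps4_def ex le)
  ultimately show ?thesis by (simp only: multihom_monom4)
qed


section \<open>Values of generic multilinear forms\<close>

text \<open>A factor on which the form does not depend has the dummy index \<open>0\<close>.\<close>

definition pivot :: "mdeg \<Rightarrow> midx \<Rightarrow> midx" where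
  "pivot t \<mu> = (case t of (t1, t2, t3, t4) \<Rightarrow> case \<mu> of (a, b, c, d) \<Rightarrow>
     (if t1 then a else 0, if t2 then b else 0, if t3 then c else 0, if t4 then d else 0))"

abbreviation all_degs :: mdeg where
  "all_degs \<equiv> (True, True, True, True)"

text \<open>Affine coordinates of the point in the chart where the coordinates selected by
  \<open>\<mu>\<close> are nonzero. Their number is at most \<open>2 * n + 2 * m\<close>, the
  dimension of X.\<close>

definition ratios :: "nat \<Rightarrow> nat \<Rightarrow> pt \<Rightarrow> midx \<Rightarrow> complex set" where
  "ratios n m p \<mu> = (case p of (x, y, z, w) \<Rightarrow> case \<mu> of (a, b, c, d) \<Rightarrow>
     (\<lambda>i. x i / x a) ` ({..n} - {a}) \<union> (\<lambda>i. y i / y b) ` ({..n} - {b}) \<union>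
     ((\<lambda>i. z i / z c) ` ({..m} - {c}) \<union> (\<lambda>i. w i / w d) ` ({..m} - {d})))"

lemma finite_ratios: "finite (ratios n m p \<mu>)"
  by (cases p; cases \<mu>) (simp add: ratios_def)

lemma card_ratios:
  assumes "\<mu> \<in> multilin_idx n m all_degs"
  shows "card (ratios n m p \<mu>) \<le> 2 * n + 2 * m"
proof -
  obtain x y z w a b c d where eq: "p = (x, y, z, w)" "\<mu> = (a, b, c, d)" by (cases p; cases \<mu>)
  have *: "card ((\<lambda>i. f i / f a) ` ({..N} - {a})) \<le> N" if "a \<le> N" for f :: "nat \<Rightarrow> complex" and a N
    using card_image_le[of "{..N} - {a}" "\<lambda>i. f i / f a"] that by simp
  have "card (ratios n m p \<mu>) \<le> (n + n) + (m + m)"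
    unfolding ratios_def eq case_prod_conv
    using assms
    by (intro order_trans[OF card_Un_le] add_mono *) (auto simp: multilin_idx_def eq)
  then show ?thesis by simp
qed

lemma multilin_pivot_nonzero:
  "multilin all_degs \<mu> p \<noteq> 0 \<Longrightarrow> multilin t (pivot t \<mu>) p \<noteq> 0"
  by (cases t; cases \<mu>; cases p) (auto simp: multilin_def pivot_def)

lemma pivot_in_idx: "\<mu> \<in> multilin_idx n m all_degs \<Longrightarrow> pivot t \<mu> \<in> multilin_idx n m t"
  by (cases t; cases \<mu>) (auto simp: multilin_idx_def pivot_def)

lemma multilin_ratio_field_gen:
  assumes nz: "multilin all_degs \<mu> p \<noteq> 0" and \<nu>: "\<nu> \<in> multilin_idx n m t"
  shows "multilin t \<nu> p / multilin t (pivot t \<mu>) p \<in> field_gen (ratios n m p \<mu>)"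
proof -
  obtain x y z w a b c d where eq: "p = (x, y, z, w)" "\<mu> = (a, b, c, d)" by (cases p; cases \<mu>)
  obtain t1 t2 t3 t4 a' b' c' d' where eq': "t = (t1, t2, t3, t4)" "\<nu> = (a', b', c', d')"
    by (cases t; cases \<nu>)
  have nz': "x a \<noteq> 0" "y b \<noteq> 0" "z c \<noteq> 0" "w d \<noteq> 0"
    using nz by (auto simp: multilin_def eq)
  have le: "t1 \<Longrightarrow> a' \<le> n" "t2 \<Longrightarrow> b' \<le> n" "t3 \<Longrightarrow> c' \<le> m" "t4 \<Longrightarrow> d' \<le> m"
    using \<nu> by (auto simp: multilin_idx_def eq')
  have *: "(if s then f i / f j else 1) \<in> field_gen S"
    if "(\<lambda>i. f i / f j) ` ({..N} - {j}) \<subseteq> S" "s \<Longrightarrow> i \<le> N" "f j \<noteq> 0"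
    for f :: "nat \<Rightarrow> complex" and s i j N S
    using that by (cases "i = j") (auto intro: field_gen.base field_gen.one)
  have "multilin t \<nu> p / multilin t (pivot t \<mu>) p =
      (if t1 then x a' / x a else 1) * (if t2 then y b' / y b else 1) *
      (if t3 then z c' / z c else 1) * (if t4 then w d' / w d else 1)"
    by (simp add: multilin_def pivot_def eq eq')
  also have "\<dots> \<in> field_gen (ratios n m p \<mu>)"
    using nz' le by (intro field_gen.mult *[of x a n] *[of y b n] *[of z c m] *[of w d m])
      (auto simp: ratios_def eq)
  finally show ?thesis .
qed

definition mform :: "nat \<Rightarrow> nat \<Rightarrow> ((mdeg \<times> 'r) \<times> midx \<Rightarrow> complex) \<Rightarrow> mdeg \<times> 'r \<Rightarrow> pt \<Rightarrow> complex" where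
  "mform n m c \<rho> p = (\<Sum>\<mu>\<in>multilin_idx n m (fst \<rho>). c (\<rho>, \<mu>) * multilin (fst \<rho>) \<mu> p)"

text \<open>The value in the affine chart: dividing by the pivot monomial removes the scaling of
  homogeneous coordinates and gives the pivot coefficient weight one.\<close>

definition nform :: "nat \<Rightarrow> nat \<Rightarrow> ((mdeg \<times> 'r) \<times> midx \<Rightarrow> complex) \<Rightarrow> midx \<Rightarrow> mdeg \<times> 'r \<Rightarrow> pt \<Rightarrow> complex" where
  "nform n m c \<mu> \<rho> p = mform n m c \<rho> p / multilin (fst \<rho>) (pivot (fst \<rho>) \<mu>) p"

lemma multihom_mform:
  "multihom n m (of_bool t1, of_bool t2, of_bool t3, of_bool t4) (mform n m c ((t1, t2, t3, t4), r))"
  unfolding mform_def fst_conv by (intro multihom_sum multihom_cmult multihom_multilin)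

lemma mform_eq_nform:
  "multilin all_degs \<mu> p \<noteq> 0 \<Longrightarrow>
    mform n m c \<rho> p = multilin (fst \<rho>) (pivot (fst \<rho>) \<mu>) p * nform n m c \<mu> \<rho> p"
  by (simp add: nform_def multilin_pivot_nonzero)

lemma nform_eq:
  assumes nz: "multilin all_degs \<mu> p \<noteq> 0" and \<mu>: "\<mu> \<in> multilin_idx n m all_degs"
  shows "nform n m c \<mu> \<rho> p = c (\<rho>, pivot (fst \<rho>) \<mu>) +
    (\<Sum>\<nu>\<in>multilin_idx n m (fst \<rho>) - {pivot (fst \<rho>) \<mu>}.
       c (\<rho>, \<nu>) * (multilin (fst \<rho>) \<nu> p / multilin (fst \<rho>) (pivot (fst \<rho>) \<mu>) p))"
proof -
  have "nform n m c \<mu> \<rho> p = (\<Sum>\<nu>\<in>multilin_idx n m (fst \<rho>).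
       c (\<rho>, \<nu>) * (multilin (fst \<rho>) \<nu> p / multilin (fst \<rho>) (pivot (fst \<rho>) \<mu>) p))"
    by (simp add: nform_def mform_def sum_divide_distrib)
  also have "\<dots> = c (\<rho>, pivot (fst \<rho>) \<mu>) +
    (\<Sum>\<nu>\<in>multilin_idx n m (fst \<rho>) - {pivot (fst \<rho>) \<mu>}.
       c (\<rho>, \<nu>) * (multilin (fst \<rho>) \<nu> p / multilin (fst \<rho>) (pivot (fst \<rho>) \<mu>) p))"
    using multilin_pivot_nonzero[OF nz, of "fst \<rho>"]
    by (subst sum.remove[OF finite_multilin_idx pivot_in_idx[OF \<mu>, of "fst \<rho>"]]) simp
  finally show ?thesis .
qed

definition coeff_idx :: "nat \<Rightarrow> nat \<Rightarrow> (mdeg \<times> 'r) set \<Rightarrow> ((mdeg \<times> 'r) \<times> midx) set" where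
  "coeff_idx n m R = (SIGMA \<rho>:R. multilin_idx n m (fst \<rho>))"

text \<open>What remains of the coefficients when each form in \<open>R0\<close> gives up its pivot
  coefficient.\<close>

definition free_coeffs :: "nat \<Rightarrow> nat \<Rightarrow> ((mdeg \<times> 'r) \<times> midx \<Rightarrow> complex) \<Rightarrow> midx \<Rightarrow>
    (mdeg \<times> 'r) set \<Rightarrow> (mdeg \<times> 'r) set \<Rightarrow> complex set" where
  "free_coeffs n m c \<mu> R R0 = c ` (coeff_idx n m R - (\<lambda>\<rho>. (\<rho>, pivot (fst \<rho>) \<mu>)) ` R0)"

lemma nform_field_gen:
  assumes "multilin all_degs \<mu> p \<noteq> 0" "\<mu> \<in> multilin_idx n m all_degs" "\<rho> \<in> R - R0"
  shows "nform n m c \<mu> \<rho> p \<in> field_gen (ratios n m p \<mu> \<union> free_coeffs n m c \<mu> R R0)"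
proof -
  have "c (\<rho>, \<nu>) \<in> free_coeffs n m c \<mu> R R0" if "\<nu> \<in> multilin_idx n m (fst \<rho>)" for \<nu>
    using assms(3) that by (auto simp: free_coeffs_def coeff_idx_def)
  then have "c (\<rho>, \<nu>) \<in> field_gen (ratios n m p \<mu> \<union> free_coeffs n m c \<mu> R R0)"
    if "\<nu> \<in> multilin_idx n m (fst \<rho>)" for \<nu>
    using that by (simp add: field_gen.base)
  moreover have "multilin t \<nu> p / multilin t (pivot t \<mu>) p
      \<in> field_gen (ratios n m p \<mu> \<union> free_coeffs n m c \<mu> R R0)"
    if "\<nu> \<in> multilin_idx n m t" for t \<nu>
    using multilin_ratio_field_gen[OF assms(1) that] field_gen_mono[of "ratios n m p \<mu>"] by blast
  ultimately show ?thesis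
    unfolding nform_eq[OF assms(1,2)] using pivot_in_idx[OF assms(2)]
    by (intro field_gen.add field_gen_sum field_gen.mult) auto
qed

text \<open>At a given point the value of a generic form determines its pivot coefficient, so generic
values cannot satisfy more relations than there are parameters for the point.\<close>

lemma generic_values_card_le:
  assumes R: "finite R" "R0 \<subseteq> R" and c: "alg_indep (coeff_idx n m R) c"
    and nz: "multilin all_degs \<mu> p \<noteq> 0" and \<mu>: "\<mu> \<in> multilin_idx n m all_degs" and T: "finite T"
    and val: "\<And>\<rho>. \<rho> \<in> R0 \<Longrightarrow>
      nform n m c \<mu> \<rho> p \<in> field_gen (ratios n m p \<mu> \<union> free_coeffs n m c \<mu> R R0 \<union> T)"
  shows "card R0 \<le> 2 * n + 2 * m + card T"
proof (rule ccontr)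
  assume less: "\<not> ?thesis"
  define I where "I = coeff_idx n m R"
  define J where "J = (\<lambda>\<rho>. (\<rho>, pivot (fst \<rho>) \<mu>)) ` R0"
  define S where "S = ratios n m p \<mu> \<union> free_coeffs n m c \<mu> R R0 \<union> T"
  have I: "finite I" unfolding I_def coeff_idx_def using R(1) finite_multilin_idx by blast
  have J: "J \<subseteq> I" unfolding J_def I_def coeff_idx_def using R(2) pivot_in_idx[OF \<mu>] by auto
  have cJ: "card J = card R0" unfolding J_def by (intro card_image) (auto simp: inj_on_def)
  have free: "free_coeffs n m c \<mu> R R0 = c ` (I - J)" by (simp add: free_coeffs_def I_def J_def)
  \<comment> \<open>The point and \<open>T\<close> bring in fewer numbers than the
    \<open>card R0\<close> pivot coefficients that were left out.\<close>
  have "card S \<le> (2 * n + 2 * m) + card (I - J) + card T"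
    unfolding S_def free
    by (intro order_trans[OF card_Un_le] add_mono card_ratios[OF \<mu>] card_image_le)
      (use I in auto)
  also have "\<dots> < card R0 + card (I - J)" using less by simp
  also have "\<dots> = card I"
    using card_Diff_subset[OF finite_subset[OF J I] J] card_mono[OF I J] by (simp add: cJ)
  finally have "card S < card I" .
  moreover have "finite S" unfolding S_def free using I T by (simp add: finite_ratios)
  moreover have "c ` I \<subseteq> field_gen S"
  proof
    fix v assume "v \<in> c ` I"
    then obtain \<iota> where \<iota>: "\<iota> \<in> I" "v = c \<iota>" by blast
    show "v \<in> field_gen S"
    proof (cases "\<iota> \<in> J")
      case False
      then show ?thesis using \<iota> by (auto simp: S_def free intro: field_gen.base)
    next
      case True
      then obtain \<rho> where \<rho>: "\<rho> \<in> R0" "\<iota> = (\<rho>, pivot (fst \<rho>) \<mu>)" by (auto simp: J_def)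
      have others: "c (\<rho>, \<nu>) \<in> field_gen S"
        if "\<nu> \<in> multilin_idx n m (fst \<rho>) - {pivot (fst \<rho>) \<mu>}" for \<nu>
      proof -
        have "(\<rho>, \<nu>) \<in> I - J"
          using that \<rho>(1) R(2) by (auto simp: I_def J_def coeff_idx_def)
        then show ?thesis by (auto simp: S_def free intro: field_gen.base)
      qed
      have ratio: "multilin t \<nu> p / multilin t (pivot t \<mu>) p \<in> field_gen S"
        if "\<nu> \<in> multilin_idx n m t" for t \<nu>
        using multilin_ratio_field_gen[OF nz that] field_gen_mono[of "ratios n m p \<mu>" S]
        by (auto simp: S_def)
      \<comment> \<open>With weight one in the value, the pivot coefficient can be solved
        for.\<close>
      have "v = nform n m c \<mu> \<rho> p - (\<Sum>\<nu>\<in>multilin_idx n m (fst \<rho>) - {pivot (fst \<rho>) \<mu>}.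
       c (\<rho>, \<nu>) * (multilin (fst \<rho>) \<nu> p / multilin (fst \<rho>) (pivot (fst \<rho>) \<mu>) p))"
        by (simp add: nform_eq[OF nz \<mu>] \<iota> \<rho>)
      also have "\<dots> \<in> field_gen S"
        using val[OF \<rho>(1)] unfolding S_def[symmetric]
        by (intro field_gen.diff field_gen_sum field_gen.mult others ratio) auto
      finally show ?thesis .
    qed
  qed
  ultimately show False
    using alg_indep_not_field_gen[OF I _ \<open>finite S\<close>] c unfolding I_def by blast
qed

section \<open>The monad\<close>

definition blocks :: "nat \<Rightarrow> nat \<Rightarrow> (nat \<Rightarrow> 'a) \<Rightarrow> (nat \<Rightarrow> 'a) \<Rightarrow> (nat \<Rightarrow> 'a) \<Rightarrow> (nat \<Rightarrow> 'a) \<Rightarrow> nat \<Rightarrow> 'a" where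
  "blocks a b h1 h2 h3 h4 i = (if i < a then h1 i else if i < a + a then h2 (i - a)
     else if i < a + a + b then h3 (i - (a + a)) else h4 (i - (a + a + b)))"

lemma blocks_simps:
  "i < a \<Longrightarrow> blocks a b h1 h2 h3 h4 i = h1 i"
  "i < a \<Longrightarrow> blocks a b h1 h2 h3 h4 (a + i) = h2 i"
  "i < b \<Longrightarrow> blocks a b h1 h2 h3 h4 (a + a + i) = h3 i"
  "blocks a b h1 h2 h3 h4 (a + a + b + i) = h4 i"
  by (simp_all add: blocks_def)

lemma blocks_cases:
  fixes i a b :: nat
  assumes "i < a + a + b + b"
  obtains i' where "i' < a" "i = i'" | i' where "i' < a" "i = a + i'"
    | i' where "i' < b" "i = a + a + i'" | i' where "i' < b" "i = a + a + b + i'"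
proof -
  have "i < a \<or> (a \<le> i \<and> i < a + a) \<or> (a + a \<le> i \<and> i < a + a + b) \<or> a + a + b \<le> i"
    by linarith
  then consider "i < a" | "a \<le> i" "i < a + a" | "a + a \<le> i" "i < a + a + b" | "a + a + b \<le> i"
    by blast
  then show ?thesis
  proof cases
    case 1
    then show ?thesis by (intro that(1)[of i]) auto
  next
    case 2
    then show ?thesis by (intro that(2)[of "i - a"]) auto
  next
    case 3
    then show ?thesis by (intro that(3)[of "i - (a + a)"]) auto
  next
    case 4
    then show ?thesis using assms by (intro that(4)[of "i - (a + a + b)"]) auto
  qed
qed

lemma length_G: "length (G_n n k @ G_m m k) = (n + k) + (n + k) + (m + k) + (m + k)"
  by (simp add: G_n_def G_m_def)

lemma nth_G:
  assumes "i < (n + k) + (n + k) + (m + k) + (m + k)"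
  shows "(G_n n k @ G_m m k) ! i = blocks (n + k) (m + k) (\<lambda>_. (0, -1, 0, 0)) (\<lambda>_. (-1, 0, 0, 0))
     (\<lambda>_. (0, 0, -1, 0)) (\<lambda>_. (0, 0, 0, -1)) i"
  using assms by (cases rule: blocks_cases) (simp_all add: blocks_simps G_n_def G_m_def nth_append)

lemma sum_blocks_mult:
  fixes g1 :: "nat \<Rightarrow> 'a::comm_semiring_0"
  shows "(\<Sum>i<a + a + b + b. blocks a b g1 g2 g3 g4 i * blocks a b f1 f2 f3 f4 i)
    = (\<Sum>i<a. g1 i * f1 i) + (\<Sum>i<a. g2 i * f2 i) + (\<Sum>i<b. g3 i * f3 i) + (\<Sum>i<b. g4 i * f4 i)"
  unfolding sum_lessThan_add by (simp add: blocks_simps cong: sum.cong_simp)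

abbreviation "degF1 \<equiv> (True, False, True, True)"
abbreviation "degF2 \<equiv> (False, True, True, True)"
abbreviation "degF3 \<equiv> (True, True, False, True)"
abbreviation "degF4 \<equiv> (True, True, True, False)"
abbreviation "degXY \<equiv> (True, True, False, False)"
abbreviation "degZW \<equiv> (False, False, True, True)"

text \<open>Labels of the generic forms: \<open>(t, 0, l)\<close> for the \<open>l\<close>-th coefficient of the polynomial of
multidegree \<open>t\<close>, and \<open>(t, j, l)\<close> for the entry \<open>(j, l)\<close> of the matrix \<open>\<pi>\<close> or \<open>\<pi>'\<close>.\<close>

definition p_rows :: "nat \<Rightarrow> nat \<Rightarrow> (mdeg \<times> nat \<times> nat) set" where
  "p_rows n m = {degF1} \<times> {0} \<times> {..n} \<union> {degF2} \<times> {0} \<times> {..n} \<union>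
     {degF3} \<times> {0} \<times> {..m} \<union> {degF4} \<times> {0} \<times> {..m}"

definition q_rows :: "nat \<Rightarrow> nat \<Rightarrow> nat \<Rightarrow> nat set \<Rightarrow> (mdeg \<times> nat \<times> nat) set" where
  "q_rows n m k J = {degXY} \<times> J \<times> {..<2 * n + k} \<union> {degZW} \<times> J \<times> {..<2 * m + k}"

lemma card_p_rows: "card (p_rows n m) = 2 * n + 2 * m + 4"
  unfolding p_rows_def
  by (subst card_Un_disjoint; (subst card_Un_disjoint)?; (subst card_Un_disjoint)?;
      auto simp: card_cartesian_product)

lemma card_p_rows_q_rows:
  "card (p_rows n m \<union> q_rows n m k {j}) = 4 * n + 4 * m + 2 * k + 4"
proof -
  have "card (q_rows n m k {j}) = 2 * n + k + (2 * m + k)"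
    unfolding q_rows_def by (subst card_Un_disjoint) (auto simp: card_cartesian_product)
  moreover have "finite (p_rows n m)" "finite (q_rows n m k {j})" "p_rows n m \<inter> q_rows n m k {j} = {}"
    by (auto simp: p_rows_def q_rows_def)
  ultimately show ?thesis by (simp add: card_Un_disjoint card_p_rows)
qed

text \<open>When both polynomials vanish, nothing constrains \<open>\<theta>\<close> and all its
  \<open>2 * n + k\<close> entries become parameters, but the coefficients of the polynomials are
  then free of cost.\<close>

lemma annihilator_parameters:
  fixes p q \<theta> :: "nat \<Rightarrow> 'a::field_gcd"
  assumes k: "k > 0"
    and ann: "\<And>i. i < n + k \<Longrightarrow> (\<Sum>l\<le>n. p l * \<theta> (i + l)) = 0"
      "\<And>i. i < n + k \<Longrightarrow> (\<Sum>l\<le>n. q l * \<theta> (i + l)) = 0"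
  shows "\<exists>S. finite S \<and> card S \<le> (if \<exists>l\<le>n. p l \<noteq> 0 \<or> q l \<noteq> 0 then 2 * n + 2 else 2 * n + k) \<and>
    (\<forall>l\<le>n. p l \<in> field_gen S) \<and> (\<forall>l\<le>n. q l \<in> field_gen S) \<and> (\<forall>l<2 * n + k. \<theta> l \<in> field_gen S)"
proof (cases "\<exists>l\<le>n. p l \<noteq> 0 \<or> q l \<noteq> 0")
  case True
  then show ?thesis using annihilator_field_gen[OF True k ann] by simp
next
  case False
  have "card (\<theta> ` {..<2 * n + k}) \<le> 2 * n + k"
    by (rule order_trans[OF card_image_le]) auto
  then show ?thesis
    using False by (intro exI[of _ "\<theta> ` {..<2 * n + k}"]) (auto simp: field_gen_zero intro: field_gen.base)
qed

text \<open>Passes from homogeneous forms to affine values: the pivot monomials come out as a common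
  factor, and dividing by \<open>s\<close> normalises the weights.\<close>

lemma scaled_combination:
  fixes c P p :: "nat \<Rightarrow> 'a::field"
  assumes "\<And>j l. Q j l = \<kappa> * q j l" "\<And>l. P l = \<kappa>' * p l" "s \<noteq> 0"
  shows "(\<Sum>j<k. c j * (\<Sum>l\<le>N. Q j (i + l) * P l))
    = s * \<kappa> * \<kappa>' * (\<Sum>l\<le>N. p l * (\<Sum>j<k. c j / s * q j (i + l)))"
  unfolding sum_distrib_left
  by (subst sum.swap) (use assms(3) in \<open>simp add: assms(1,2) mult_ac\<close>)

section \<open>The maps f and g for one generic choice of coefficients\<close>

locale generic_monad =
  fixes n m k :: nat and c :: "(mdeg \<times> nat \<times> nat) \<times> midx \<Rightarrow> complex"
  assumes k_pos: "k > 0"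
    and alg_indep: "alg_indep (coeff_idx n m (p_rows n m \<union> q_rows n m k {..<k})) c"
begin

abbreviation "P t l \<equiv> mform n m c (t, 0, l)"
abbreviation "Q t j l \<equiv> mform n m c (t, j, l)"

definition toep :: "nat \<Rightarrow> mdeg \<Rightarrow> nat \<Rightarrow> nat \<Rightarrow> pt \<Rightarrow> complex" where
  "toep N t j i p = (if j \<le> i \<and> i - j \<le> N then P t (i - j) p else 0)"

text \<open>Row \<open>j\<close> of the generic matrix, as a functional on polynomials, evaluated on
  the \<open>i\<close>-th shift of the polynomial of type \<open>t\<close>. For
  \<open>i < N + k\<close> the index \<open>i + l\<close> stays below \<open>2 * N + k\<close>, the
  width of that matrix.\<close>

definition pairing :: "nat \<Rightarrow> mdeg \<Rightarrow> mdeg \<Rightarrow> nat \<Rightarrow> nat \<Rightarrow> pt \<Rightarrow> complex" where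
  "pairing N s t j i p = (\<Sum>l\<le>N. Q s j (i + l) p * P t l p)"

definition alpha :: "nat \<Rightarrow> nat \<Rightarrow> pt \<Rightarrow> complex" where
  "alpha i j p = blocks (n + k) (m + k) (\<lambda>i. toep n degF1 j i p) (\<lambda>i. toep n degF2 j i p)
     (\<lambda>i. toep m degF3 j i p) (\<lambda>i. toep m degF4 j i p) i"

text \<open>Each block uses the partner of the polynomial in the same block of \<open>alpha\<close>,
  and partners carry opposite signs; so the contributions cancel in pairs.\<close>

definition beta :: "nat \<Rightarrow> nat \<Rightarrow> pt \<Rightarrow> complex" where
  "beta j i p = blocks (n + k) (m + k) (\<lambda>i. pairing n degXY degF2 j i p) (\<lambda>i. - pairing n degXY degF1 j i p)
     (\<lambda>i. pairing m degZW degF4 j i p) (\<lambda>i. - pairing m degZW degF3 j i p) i"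

lemma sum_pairing_toep:
  assumes "j' < k"
  shows "(\<Sum>i<N + k. pairing N s t j i p * toep N t' j' i p)
    = (\<Sum>r\<le>N. \<Sum>l\<le>N. Q s j (j' + r + l) p * P t l p * P t' r p)"
  using sum_toeplitz_column[OF assms, where h = "\<lambda>i. pairing N s t j i p" and p = "\<lambda>r. P t' r p"]
  by (simp add: toep_def pairing_def sum_distrib_right)

text \<open>Both sides apply the functional to the \<open>j'\<close>-th shift of the product of the
  two polynomials, and this product commutes.\<close>

lemma sum_pairing_toep_commute:
  assumes "j' < k"
  shows "(\<Sum>i<N + k. pairing N s t j i p * toep N t' j' i p)
    = (\<Sum>i<N + k. pairing N s t' j i p * toep N t j' i p)"
  unfolding sum_pairing_toep[OF assms] by (subst sum.swap) (simp add: ac_simps)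

lemma beta_alpha:
  assumes "j' < k"
  shows "(\<Sum>i<(n + k) + (n + k) + (m + k) + (m + k). beta j i p * alpha i j' p) = 0"
  unfolding alpha_def beta_def sum_blocks_mult
  using sum_pairing_toep_commute[OF assms, where N = n and s = degXY and t = degF2 and t' = degF1]
    sum_pairing_toep_commute[OF assms, where N = m and s = degZW and t = degF4 and t' = degF3]
  by (simp add: sum_negf)

lemma multihom_toep:
  "multihom n m (of_bool t1, of_bool t2, of_bool t3, of_bool t4) (toep N (t1, t2, t3, t4) j i)"
proof (cases "j \<le> i \<and> i - j \<le> N")
  case True
  then have "toep N (t1, t2, t3, t4) j i = P (t1, t2, t3, t4) (i - j)"
    by (simp add: toep_def fun_eq_iff)
  then show ?thesis by (simp only: multihom_mform)
next
  case False
  then have "toep N (t1, t2, t3, t4) j i = (\<lambda>p. 0)" by (auto simp: toep_def)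
  then show ?thesis by (simp only: multihom_zero)
qed

lemma multihom_pairing:
  "multihom n m (of_bool s1 + of_bool t1, of_bool s2 + of_bool t2, of_bool s3 + of_bool t3,
     of_bool s4 + of_bool t4) (pairing N (s1, s2, s3, s4) (t1, t2, t3, t4) j i)"
  unfolding pairing_def by (intro multihom_sum multihom_mult multihom_mform)

lemma is_morphism_alpha: "is_morphism n m (replicate k (-1, -1, -1, -1)) (G_n n k @ G_m m k) alpha"
proof -
  have "multihom n m (twist_diff ((G_n n k @ G_m m k) ! i) (-1, -1, -1, -1)) (alpha i j)"
    if i: "i < (n + k) + (n + k) + (m + k) + (m + k)" for i j
    using i
    by (cases rule: blocks_cases; unfold nth_G[OF i] alpha_def[abs_def])
      (simp_all only: blocks_simps twist_diff_def case_prod_conv,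
        use multihom_toep[of True False True True n j] multihom_toep[of False True True True n j]
          multihom_toep[of True True False True m j] multihom_toep[of True True True False m j]
        in \<open>simp_all\<close>)
  then show ?thesis by (simp add: is_morphism_def length_G del: length_append)
qed

text \<open>Multidegrees add: \<open>degXY\<close> and \<open>degF2\<close> give (1,2,1,1), which is
  (1,1,1,1) minus (0,-1,0,0). The other three blocks are alike.\<close>

lemma is_morphism_beta: "is_morphism n m (G_n n k @ G_m m k) (replicate k (1, 1, 1, 1)) beta"
proof -
  have "multihom n m (twist_diff (1, 1, 1, 1) ((G_n n k @ G_m m k) ! i)) (beta j i)"
    if i: "i < (n + k) + (n + k) + (m + k) + (m + k)" for i j
    using i
    by (cases rule: blocks_cases; unfold nth_G[OF i] beta_def[abs_def])
      (simp_all only: blocks_simps twist_diff_def case_prod_conv,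
        use multihom_pairing[of True False True True False True False True n j]
          multihom_uminus[OF multihom_pairing[of True True True False False True False True n j]]
          multihom_pairing[of False True False True True True True False m j]
          multihom_uminus[OF multihom_pairing[of False True False True True False True True m j]]
        in \<open>simp_all\<close>)
  then show ?thesis by (simp add: is_morphism_def length_G del: length_append)
qed

section \<open>Fibrewise injectivity and surjectivity\<close>

lemma in_X_pivot:
  assumes "in_X n m p"
  obtains \<mu> where "\<mu> \<in> multilin_idx n m all_degs" "multilin all_degs \<mu> p \<noteq> 0"
proof -
  obtain x y z w where p: "p = (x, y, z, w)" by (cases p)
  then obtain a b c d where "a \<le> n" "x a \<noteq> 0" "b \<le> n" "y b \<noteq> 0" "c \<le> m" "z c \<noteq> 0" "d \<le> m" "w d \<noteq> 0"
    using assms by (auto simp: in_X_def)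
  then have "(a, b, c, d) \<in> multilin_idx n m all_degs" "multilin all_degs (a, b, c, d) p \<noteq> 0"
    by (auto simp: multilin_idx_def multilin_def p)
  then show ?thesis by (rule that)
qed

lemma finite_rows: "finite (p_rows n m \<union> q_rows n m k {..<k})"
  by (simp add: p_rows_def q_rows_def)

text \<open>A common zero would determine \<open>2 * n + 2 * m + 4\<close> generic pivot
  coefficients from the \<open>2 * n + 2 * m\<close> parameters of a point.\<close>

lemma P_not_all_zero:
  assumes "in_X n m p"
  shows "(\<exists>l\<le>n. P degF1 l p \<noteq> 0 \<or> P degF2 l p \<noteq> 0) \<or> (\<exists>l\<le>m. P degF3 l p \<noteq> 0 \<or> P degF4 l p \<noteq> 0)"
proof (rule ccontr)
  assume "\<not> ?thesis"
  then have zero: "mform n m c \<rho> p = 0" if "\<rho> \<in> p_rows n m" for \<rho>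
    using that by (auto simp: p_rows_def)
  obtain \<mu> where \<mu>: "\<mu> \<in> multilin_idx n m all_degs" "multilin all_degs \<mu> p \<noteq> 0"
    using in_X_pivot[OF assms] .
  have "card (p_rows n m) \<le> 2 * n + 2 * m + card ({}::complex set)"
    by (rule generic_values_card_le[OF finite_rows _ alg_indep \<mu>(2,1)])
      (auto simp: nform_def zero field_gen_zero)
  then show False by (simp add: card_p_rows)
qed

text \<open>A single nonzero polynomial among the four already makes its Toeplitz block
  injective.\<close>

lemma alpha_injective:
  assumes "in_X n m p"
    and eq: "\<And>i. i < (n + k) + (n + k) + (m + k) + (m + k) \<Longrightarrow> (\<Sum>j<k. alpha i j p * v j) = 0"
  shows "\<forall>j<k. v j = 0"
proof -
  have inj: "\<forall>j<k. v j = 0"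
    if "l \<le> N" "P t l p \<noteq> 0" "\<And>i. i < N + k \<Longrightarrow> (\<Sum>j<k. toep N t j i p * v j) = 0" for N t l
    using toeplitz_injective[of l N "\<lambda>l. P t l p" k v] that unfolding toep_def by blast
  have eqs: "i < n + k \<Longrightarrow> (\<Sum>j<k. toep n degF1 j i p * v j) = 0"
    "i < n + k \<Longrightarrow> (\<Sum>j<k. toep n degF2 j i p * v j) = 0"
    "i < m + k \<Longrightarrow> (\<Sum>j<k. toep m degF3 j i p * v j) = 0"
    "i < m + k \<Longrightarrow> (\<Sum>j<k. toep m degF4 j i p * v j) = 0" for i
    using eq[of i] eq[of "(n + k) + i"] eq[of "(n + k) + (n + k) + i"]
      eq[of "(n + k) + (n + k) + (m + k) + i"]
    unfolding alpha_def by (simp_all only: blocks_simps)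
  show ?thesis
    using P_not_all_zero[OF assms(1)] inj[OF _ _ eqs(1)] inj[OF _ _ eqs(2)]
      inj[OF _ _ eqs(3)] inj[OF _ _ eqs(4)] by blast
qed

text \<open>A relation between the rows would recover the \<open>4 * n + 4 * m + 2 * k + 4\<close>
  pivot coefficients of the polynomials and of row \<open>j0\<close> of both matrices from one
  parameter fewer: \<open>2 * n + 2 * m\<close> for the point, \<open>k - 1\<close> for the
  relation, and \<open>2 * n + 2 * m + k + 4\<close> for polynomials and functionals.\<close>

lemma beta_rows_independent:
  assumes X: "in_X n m p"
    and eq: "\<And>i. i < (n + k) + (n + k) + (m + k) + (m + k) \<Longrightarrow> (\<Sum>j<k. b j * beta j i p) = 0"
  shows "\<forall>j<k. b j = 0"
proof (rule ccontr)
  assume "\<not> ?thesis"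
  then obtain j0 where j0: "j0 < k" "b j0 \<noteq> 0" by blast
  obtain \<mu> where \<mu>: "\<mu> \<in> multilin_idx n m all_degs" "multilin all_degs \<mu> p \<noteq> 0"
    using in_X_pivot[OF X] .
  \<comment> \<open>Normalising at \<open>j0\<close> leaves \<open>k - 1\<close> unknown
    weights.\<close>
  define \<omega> where "\<omega> j = b j / b j0" for j
  \<comment> \<open>The weighted combination of the rows of the generic matrix; the relation makes
    it annihilate the shifts of the polynomials.\<close>
  define \<theta> where "\<theta> t l = (\<Sum>j<k. \<omega> j * nform n m c \<mu> (t, j, l) p)" for t l
  define N where "N t l = nform n m c \<mu> (t, 0::nat, l::nat) p" for t l
  have eqs: "i < n + k \<Longrightarrow> (\<Sum>j<k. b j * pairing n degXY degF2 j i p) = 0"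
    "i < n + k \<Longrightarrow> (\<Sum>j<k. b j * pairing n degXY degF1 j i p) = 0"
    "i < m + k \<Longrightarrow> (\<Sum>j<k. b j * pairing m degZW degF4 j i p) = 0"
    "i < m + k \<Longrightarrow> (\<Sum>j<k. b j * pairing m degZW degF3 j i p) = 0" for i
    using eq[of i] eq[of "(n + k) + i"] eq[of "(n + k) + (n + k) + i"]
      eq[of "(n + k) + (n + k) + (m + k) + i"]
    unfolding beta_def by (simp_all only: blocks_simps mult_minus_right sum_negf neg_equal_0_iff_equal)
  have mf: "mform n m c (t, j, l) p = multilin t (pivot t \<mu>) p * nform n m c \<mu> (t, j, l) p" for t j l
    using mform_eq_nform[OF \<mu>(2), of n m c "(t, j, l)"] by simp
  have ann: "(\<Sum>l\<le>M. N t l * \<theta> s (i + l)) = 0" if "(\<Sum>j<k. b j * pairing M s t j i p) = 0" for M s t i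
  proof -
    have "(\<Sum>j<k. b j * pairing M s t j i p) = b j0 * multilin s (pivot s \<mu>) p * multilin t (pivot t \<mu>) p *
        (\<Sum>l\<le>M. N t l * (\<Sum>j<k. b j / b j0 * nform n m c \<mu> (s, j, i + l) p))"
      unfolding pairing_def N_def
      by (rule scaled_combination) (rule mf, rule mf, rule j0(2))
    then show ?thesis
      using that j0 multilin_pivot_nonzero[OF \<mu>(2)] by (simp add: \<theta>_def \<omega>_def)
  qed
  obtain S where S: "finite S" "card S \<le> (if \<exists>l\<le>n. N degF1 l \<noteq> 0 \<or> N degF2 l \<noteq> 0 then 2 * n + 2 else 2 * n + k)"
    "\<And>l. l \<le> n \<Longrightarrow> N degF1 l \<in> field_gen S" "\<And>l. l \<le> n \<Longrightarrow> N degF2 l \<in> field_gen S"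
    "\<And>l. l < 2 * n + k \<Longrightarrow> \<theta> degXY l \<in> field_gen S"
    using annihilator_parameters[OF k_pos, of n "N degF1" "\<theta> degXY" "N degF2"]
      ann[OF eqs(2)] ann[OF eqs(1)] by blast
  obtain S' where S': "finite S'" "card S' \<le> (if \<exists>l\<le>m. N degF3 l \<noteq> 0 \<or> N degF4 l \<noteq> 0 then 2 * m + 2 else 2 * m + k)"
    "\<And>l. l \<le> m \<Longrightarrow> N degF3 l \<in> field_gen S'" "\<And>l. l \<le> m \<Longrightarrow> N degF4 l \<in> field_gen S'"
    "\<And>l. l < 2 * m + k \<Longrightarrow> \<theta> degZW l \<in> field_gen S'"
    using annihilator_parameters[OF k_pos, of m "N degF3" "\<theta> degZW" "N degF4"]
      ann[OF eqs(4)] ann[OF eqs(3)] by blast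
  \<comment> \<open>One of the two pairs of polynomials is nonzero, so the more expensive bound with
    \<open>k\<close> is incurred for at most one pair.\<close>
  have nonzero: "(\<exists>l\<le>n. N degF1 l \<noteq> 0 \<or> N degF2 l \<noteq> 0) \<or> (\<exists>l\<le>m. N degF3 l \<noteq> 0 \<or> N degF4 l \<noteq> 0)"
    using P_not_all_zero[OF X] multilin_pivot_nonzero[OF \<mu>(2)] by (simp add: N_def nform_def)
  define L where "L = \<omega> ` ({..<k} - {j0})"
  define T where "T = L \<union> (S \<union> S')"
  have finT: "finite T" by (simp add: T_def L_def S(1) S'(1))
  have "card L \<le> k - 1"
    unfolding L_def using card_image_le[of "{..<k} - {j0}" \<omega>] j0(1) by simp
  then have cardT: "card T \<le> (k - 1) + (card S + card S')"
    unfolding T_def by (intro order_trans[OF card_Un_le] add_mono) auto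
  let ?R = "p_rows n m \<union> q_rows n m k {..<k}"
  let ?Rj = "p_rows n m \<union> q_rows n m k {j0}"
  let ?K = "field_gen (ratios n m p \<mu> \<union> free_coeffs n m c \<mu> ?R ?Rj \<union> T)"
  have sub: "field_gen S \<subseteq> ?K" "field_gen S' \<subseteq> ?K"
    by (auto simp: T_def intro!: field_gen_mono)
  \<comment> \<open>As \<open>\<omega> j0 = 1\<close>, row \<open>j0\<close> is the functional minus
    the weighted other rows, whose coefficients are all free.\<close>
  have q_val: "nform n m c \<mu> (t, j0, l) p \<in> ?K"
    if "\<theta> t l \<in> ?K" "\<And>j. j < k \<Longrightarrow> j \<noteq> j0 \<Longrightarrow> (t, j, l) \<in> ?R - ?Rj" for t l
  proof -
    have "\<theta> t l = nform n m c \<mu> (t, j0, l) p + (\<Sum>j\<in>{..<k} - {j0}. \<omega> j * nform n m c \<mu> (t, j, l) p)"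
      unfolding \<theta>_def using j0 by (subst sum.remove[of _ j0]) (auto simp: \<omega>_def)
    then have eq: "nform n m c \<mu> (t, j0, l) p
        = \<theta> t l - (\<Sum>j\<in>{..<k} - {j0}. \<omega> j * nform n m c \<mu> (t, j, l) p)"
      by simp
    have "nform n m c \<mu> (t, j, l) p \<in> ?K" if "j < k" "j \<noteq> j0" for j
      using nform_field_gen[OF \<mu>(2,1) \<open>\<And>j. j < k \<Longrightarrow> j \<noteq> j0 \<Longrightarrow> (t, j, l) \<in> ?R - ?Rj\<close>[OF that]]
        field_gen_mono[of "ratios n m p \<mu> \<union> free_coeffs n m c \<mu> ?R ?Rj"
          "ratios n m p \<mu> \<union> free_coeffs n m c \<mu> ?R ?Rj \<union> T"] by blast
    moreover have "\<omega> j \<in> ?K" if "j < k" "j \<noteq> j0" for j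
      using that by (auto simp: T_def L_def intro!: field_gen.base)
    ultimately show ?thesis
      unfolding eq using that(1) by (intro field_gen.diff field_gen_sum field_gen.mult) auto
  qed
  have "card ?Rj \<le> 2 * n + 2 * m + card T"
  proof (rule generic_values_card_le[OF finite_rows _ alg_indep \<mu>(2,1) finT])
    show "?Rj \<subseteq> ?R" using j0 by (auto simp: q_rows_def)
  next
    fix \<rho> assume "\<rho> \<in> ?Rj"
    then consider
        (F1) l where "\<rho> = (degF1, 0, l)" "l \<le> n" | (F2) l where "\<rho> = (degF2, 0, l)" "l \<le> n"
      | (F3) l where "\<rho> = (degF3, 0, l)" "l \<le> m" | (F4) l where "\<rho> = (degF4, 0, l)" "l \<le> m"
      | (XY) l where "\<rho> = (degXY, j0, l)" "l < 2 * n + k"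
      | (ZW) l where "\<rho> = (degZW, j0, l)" "l < 2 * m + k"
      by (auto simp: p_rows_def q_rows_def)
    then show "nform n m c \<mu> \<rho> p \<in> ?K"
    proof cases
      case F1 then show ?thesis using S(3) sub(1) by (auto simp: N_def)
    next
      case F2 then show ?thesis using S(4) sub(1) by (auto simp: N_def)
    next
      case F3 then show ?thesis using S'(3) sub(2) by (auto simp: N_def)
    next
      case F4 then show ?thesis using S'(4) sub(2) by (auto simp: N_def)
    next
      case XY
      have "(degXY, j, l) \<in> ?R - ?Rj" if "j < k" "j \<noteq> j0" for j
        using that XY(2) by (auto simp: p_rows_def q_rows_def)
      then show ?thesis unfolding XY(1) using S(5)[OF XY(2)] sub(1) by (intro q_val) auto
    next
      case ZW
      have "(degZW, j, l) \<in> ?R - ?Rj" if "j < k" "j \<noteq> j0" for j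
        using that ZW(2) by (auto simp: p_rows_def q_rows_def)
      then show ?thesis unfolding ZW(1) using S'(5)[OF ZW(2)] sub(2) by (intro q_val) auto
    qed
  qed
  moreover have "card S + card S' \<le> 2 * n + 2 * m + k + 4"
  proof -
    \<comment> \<open>A crude bound covering both branches of the conditional; the sharp one is then
      used for a nonzero pair.\<close>
    have le: "card S \<le> 2 * n + k + 2" "card S' \<le> 2 * m + k + 2"
      using S(2) S'(2) by (simp_all only: split: if_splits)
    from nonzero show ?thesis
    proof
      assume "\<exists>l\<le>n. N degF1 l \<noteq> 0 \<or> N degF2 l \<noteq> 0"
      then have "card S \<le> 2 * n + 2" using S(2) by (simp only: if_True)
      then show ?thesis using le(2) by simp
    next
      assume "\<exists>l\<le>m. N degF3 l \<noteq> 0 \<or> N degF4 l \<noteq> 0"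
      then have "card S' \<le> 2 * m + 2" using S'(2) by (simp only: if_True)
      then show ?thesis using le(1) by simp
    qed
  qed
  ultimately show False
    using cardT k_pos unfolding card_p_rows_q_rows by linarith
qed

lemma is_monad_alpha_beta: "is_monad n m (replicate k (-1, -1, -1, -1)) (G_n n k @ G_m m k)
    (replicate k (1, 1, 1, 1)) alpha beta"
proof -
  have inj: "inj_at k ((n + k) + (n + k) + (m + k) + (m + k)) alpha p" if "in_X n m p" for p
    unfolding inj_at_def
  proof (rule allI, rule impI)
    fix v assume "\<forall>i<(n + k) + (n + k) + (m + k) + (m + k). (\<Sum>j<k. alpha i j p * v j) = 0"
    note h = this[rule_format]
    show "\<forall>j<k. v j = 0" by (rule alpha_injective[OF that h])
  qed
  have surj: "surj_at ((n + k) + (n + k) + (m + k) + (m + k)) k beta p" if "in_X n m p" for p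
    unfolding surj_at_def
  proof (rule allI, rule rows_independent_onto)
    fix b assume "\<forall>j<(n + k) + (n + k) + (m + k) + (m + k). (\<Sum>i<k. b i * beta i j p) = 0"
    note h = this[rule_format]
    show "\<forall>i<k. b i = 0" by (rule beta_rows_independent[OF that h])
  qed
  show ?thesis
    unfolding is_monad_def length_G length_replicate
    by (intro conjI allI impI is_morphism_alpha is_morphism_beta beta_alpha inj surj)
qed

end

theorem theorem4p2:
  fixes n m k :: nat
  assumes "n > 0" and "m > 0" and "k > 0"
  shows "\<exists>f g. is_monad n m (replicate k (-1, -1, -1, -1)) (G_n n k @ G_m m k)
                  (replicate k (1, 1, 1, 1)) f g"
proof -
  have "finite (coeff_idx n m (p_rows n m \<union> q_rows n m k {..<k}))"
    unfolding coeff_idx_def by (intro finite_SigmaI finite_multilin_idx) (simp add: p_rows_def q_rows_def)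
  then obtain c :: "(mdeg \<times> nat \<times> nat) \<times> midx \<Rightarrow> complex"
    where c: "alg_indep (coeff_idx n m (p_rows n m \<union> q_rows n m k {..<k})) c"
    using alg_indep_exists by blast
  interpret generic_monad n m k c
    using assms(3) c by unfold_locales
  show ?thesis using is_monad_alpha_beta by blast
qed

end
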